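(* Let $\pi:E\to M$ be a smooth vector bundle over a smooth finite-dimensional manifold $M$ that admits a finite atlas of local trivializations. Then the diffeological dual pseudo-bundle of $\pi:E\to M$, where $E$ and $M$ are endowed with the standard diffeological structure, is diffeomorphic to the usual dual vector bundle of $\pi:E\to M$ (endowed with its standard diffeology), via a diffeomorphism covering the identity on $M$.
   Context: A diffeological space is a set $X$ with a collection of maps (plots) $U\to X$, $U$ open in some $\mathbb{R}^d$, containing constant maps, closed under precomposition with usual smooth maps, and satisfying the sheaf condition. The standard diffeology of a smooth manifold consists of all usual smooth maps from such $U$ into it. A map is smooth if it carries plots to plots; a diffeomorphism is a smooth bijection with smooth inverse. A diffeological vector pseudo-bundle is a smooth surjection $\pi:V\to X$ of diffeological spaces with real vector space structures on fibres such that fibrewise addition $V\times_XV\to V$, scalar multiplication $\mathbb{R}\times V\to V$ and the zero section are smooth; a smooth vector bundle with standard diffeologies is an example. Diffeological dual pseudo-bundle $\pi^*:V^*\to X$ of a finite-dimensional pseudo-bundle $\pi:V\to X$: $V^*=\bigcup_{x\in X}(\pi^{-1}(x))^*$, where $(\pi^{-1}(x))^*$ is the space of all smooth linear maps $\pi^{-1}(x)\to\mathbb{R}$ (subset diffeology on $\pi^{-1}(x)$, standard diffeology on $\mathbb{R}$), with the obvious projection $\pi^*$. A map $p:U\to V^*$ is a plot if and only if for every plot $q:U'\to V$ the map $(u,u')\mapsto p(u)(q(u'))$, defined on $\{(u,u')\in U\times U'\mid\pi^*(p(u))=\pi(q(u'))\}$, is smooth for the subset diffeology of this set (relative to the standard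 diffeology of $U\times U'$) and the standard diffeology of $\mathbb{R}$. As in the rest of the paper's section, an atlas of local trivializations consists of open sets $U_i$ covering $M$, diffeomorphisms $\varphi_i:U_i\to\mathbb{R}^n$, and fibrewise linear diffeomorphisms $\psi_i:\pi^{-1}(U_i)\to U_i\times\mathbb{R}^k$ over $U_i$.
   Formalization: Plots p of the diffeological dual are also required to have π*∘p a plot of M; with the pairing condition alone, zero covectors over a discontinuous map into M would be plots, and the claim would fail once M has two points. *)

theory Defs
  imports "HOL-Analysis.Analysis"
begin

section \<open>Smooth functions on open subsets of Euclidean spaces of varying dimension\<close>

text \<open>
  The dimension of the domain of a plot is existentially quantified, so it cannot be a type
  parameter. The space \<open>\<real>\<^sup>d\<close> is the library's \<open>Euclidean_space d\<close>: sequences of reals that vanish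
  from index \<open>d\<close> on, with the product topology. \<open>C_k k d U f\<close> says that on the open set \<open>U\<close> all
  iterated partial derivatives of \<open>f\<close> of order at most \<open>k\<close> exist and are continuous.
\<close>

primrec C_k :: "nat \<Rightarrow> nat \<Rightarrow> (nat \<Rightarrow> real) set \<Rightarrow> ((nat \<Rightarrow> real) \<Rightarrow> real) \<Rightarrow> bool" where
  "C_k 0 d U f \<longleftrightarrow> continuous_on U f"
| "C_k (Suc k) d U f \<longleftrightarrow> continuous_on U f \<and>
     (\<exists>g. \<forall>i<d. C_k k d U (g i) \<and>
        (\<forall>x\<in>U. ((\<lambda>t. f (x(i := t))) has_real_derivative g i x) (at (x i))))"

definition smooth_real_on :: "nat \<Rightarrow> (nat \<Rightarrow> real) set \<Rightarrow> ((nat \<Rightarrow> real) \<Rightarrow> real) \<Rightarrow> bool" where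
  "smooth_real_on d U f \<longleftrightarrow> openin (Euclidean_space d) U \<and> (\<forall>k. C_k k d U f)"

definition smooth_between ::
    "nat \<Rightarrow> nat \<Rightarrow> (nat \<Rightarrow> real) set \<Rightarrow> ((nat \<Rightarrow> real) \<Rightarrow> nat \<Rightarrow> real) \<Rightarrow> bool" where
  "smooth_between d m U f \<longleftrightarrow>
     openin (Euclidean_space d) U \<and> f \<in> U \<rightarrow> topspace (Euclidean_space m) \<and>
     (\<forall>j<m. smooth_real_on d U (\<lambda>x. f x j))"


section \<open>Smooth manifolds\<close>

record 'a manifold =
  mf_top :: "'a topology"
  mf_dim :: nat
  mf_atlas :: "('a set \<times> ('a \<Rightarrow> nat \<Rightarrow> real)) set"

definition chart :: "'a topology \<Rightarrow> nat \<Rightarrow> 'a set \<Rightarrow> ('a \<Rightarrow> nat \<Rightarrow> real) \<Rightarrow> bool" where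
  "chart T n U \<phi> \<longleftrightarrow>
     openin T U \<and> openin (Euclidean_space n) (\<phi> ` U) \<and>
     homeomorphic_map (subtopology T U) (subtopology (Euclidean_space n) (\<phi> ` U)) \<phi>"

definition smooth_manifold :: "'a manifold \<Rightarrow> bool" where
  "smooth_manifold M \<longleftrightarrow>
     Hausdorff_space (mf_top M) \<and> second_countable (mf_top M) \<and>
     (\<forall>(U, \<phi>) \<in> mf_atlas M. chart (mf_top M) (mf_dim M) U \<phi>) \<and>
     (\<Union>(U, \<phi>) \<in> mf_atlas M. U) = topspace (mf_top M) \<and>
     (\<forall>(U, \<phi>) \<in> mf_atlas M. \<forall>(V, \<psi>) \<in> mf_atlas M.
        smooth_between (mf_dim M) (mf_dim M) (\<phi> ` (U \<inter> V)) (\<psi> \<circ> inv_into U \<phi>))"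

definition smooth_manifold_map :: "'a manifold \<Rightarrow> 'b manifold \<Rightarrow> ('a \<Rightarrow> 'b) \<Rightarrow> bool" where
  "smooth_manifold_map M N f \<longleftrightarrow>
     continuous_map (mf_top M) (mf_top N) f \<and>
     (\<forall>(U, \<phi>) \<in> mf_atlas M. \<forall>(V, \<psi>) \<in> mf_atlas N.
        smooth_between (mf_dim M) (mf_dim N) (\<phi> ` {x \<in> U. f x \<in> V}) (\<psi> \<circ> f \<circ> inv_into U \<phi>))"

definition manifold_diffeomorphism :: "'a manifold \<Rightarrow> 'b manifold \<Rightarrow> ('a \<Rightarrow> 'b) \<Rightarrow> bool" where
  "manifold_diffeomorphism M N f \<longleftrightarrow>
     bij_betw f (topspace (mf_top M)) (topspace (mf_top N)) \<and>
     smooth_manifold_map M N f \<and>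
     smooth_manifold_map N M (inv_into (topspace (mf_top M)) f)"

definition euclidean_manifold :: "nat \<Rightarrow> (nat \<Rightarrow> real) manifold" where
  "euclidean_manifold n =
     \<lparr> mf_top = Euclidean_space n, mf_dim = n, mf_atlas = {(topspace (Euclidean_space n), id)} \<rparr>"

text \<open>The standard structure on the type \<open>real\<close>, identified with \<open>\<real>\<^sup>1\<close>.\<close>

definition real_manifold :: "real manifold" where
  "real_manifold =
     \<lparr> mf_top = euclideanreal, mf_dim = 1, mf_atlas = {(UNIV, \<lambda>t i. if i = 0 then t else 0)} \<rparr>"

definition open_submanifold :: "'a manifold \<Rightarrow> 'a set \<Rightarrow> 'a manifold" where
  "open_submanifold M U =
     \<lparr> mf_top = subtopology (mf_top M) U, mf_dim = mf_dim M,
       mf_atlas = {(V \<inter> U, \<phi>) | V \<phi>. (V, \<phi>) \<in> mf_atlas M} \<rparr>"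

text \<open>\<open>join_coords m x y\<close> is the point \<open>(x, y)\<close> of \<open>\<real>\<^sup>m \<times> \<real>\<^sup>k = \<real>\<^sup>m\<^sup>+\<^sup>k\<close>.\<close>

definition join_coords :: "nat \<Rightarrow> (nat \<Rightarrow> real) \<Rightarrow> (nat \<Rightarrow> real) \<Rightarrow> nat \<Rightarrow> real" where
  "join_coords m x y = (\<lambda>i. if i < m then x i else y (i - m))"

definition product_manifold :: "'a manifold \<Rightarrow> 'b manifold \<Rightarrow> ('a \<times> 'b) manifold" where
  "product_manifold M N =
     \<lparr> mf_top = prod_topology (mf_top M) (mf_top N), mf_dim = mf_dim M + mf_dim N,
       mf_atlas = {(U \<times> V, \<lambda>(x, y). join_coords (mf_dim M) (\<phi> x) (\<psi> y)) | U \<phi> V \<psi>.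
                     (U, \<phi>) \<in> mf_atlas M \<and> (V, \<psi>) \<in> mf_atlas N} \<rparr>"


section \<open>Smooth vector bundles and the usual dual bundle\<close>

definition real_vector_space_on :: "'a set \<Rightarrow> ('a \<Rightarrow> 'a \<Rightarrow> 'a) \<Rightarrow> (real \<Rightarrow> 'a \<Rightarrow> 'a) \<Rightarrow> bool" where
  "real_vector_space_on S add scl \<longleftrightarrow>
     (\<forall>a\<in>S. \<forall>b\<in>S. add a b \<in> S) \<and>
     (\<forall>a\<in>S. \<forall>b\<in>S. \<forall>c\<in>S. add (add a b) c = add a (add b c)) \<and>
     (\<forall>a\<in>S. \<forall>b\<in>S. add a b = add b a) \<and>
     (\<exists>z\<in>S. (\<forall>a\<in>S. add z a = a) \<and> (\<forall>a\<in>S. \<exists>b\<in>S. add a b = z)) \<and>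
     (\<forall>r. \<forall>a\<in>S. scl r a \<in> S) \<and>
     (\<forall>r. \<forall>a\<in>S. \<forall>b\<in>S. scl r (add a b) = add (scl r a) (scl r b)) \<and>
     (\<forall>r s. \<forall>a\<in>S. scl (r + s) a = add (scl r a) (scl s a)) \<and>
     (\<forall>r s. \<forall>a\<in>S. scl (r * s) a = scl r (scl s a)) \<and>
     (\<forall>a\<in>S. scl 1 a = a)"

text \<open>
  Linear functionals on \<open>S\<close>. They are \<open>undefined\<close> off \<open>S\<close>, so that equality of functionals is
  equality on \<open>S\<close>.
\<close>

definition linear_functionals ::
    "'a set \<Rightarrow> ('a \<Rightarrow> 'a \<Rightarrow> 'a) \<Rightarrow> (real \<Rightarrow> 'a \<Rightarrow> 'a) \<Rightarrow> ('a \<Rightarrow> real) set" where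
  "linear_functionals S add scl =
     {\<xi> \<in> extensional S. (\<forall>a\<in>S. \<forall>b\<in>S. \<xi> (add a b) = \<xi> a + \<xi> b) \<and>
                         (\<forall>r. \<forall>a\<in>S. \<xi> (scl r a) = r * \<xi> a)}"

record ('e, 'm) vector_bundle =
  vb_total :: "'e manifold"
  vb_base :: "'m manifold"
  vb_proj :: "'e \<Rightarrow> 'm"
  vb_add :: "'e \<Rightarrow> 'e \<Rightarrow> 'e"
  vb_scale :: "real \<Rightarrow> 'e \<Rightarrow> 'e"
  vb_rank :: nat

definition vb_preimage :: "('e, 'm) vector_bundle \<Rightarrow> 'm set \<Rightarrow> 'e set" where
  "vb_preimage B U = {v \<in> topspace (mf_top (vb_total B)). vb_proj B v \<in> U}"

abbreviation vb_fibre :: "('e, 'm) vector_bundle \<Rightarrow> 'm \<Rightarrow> 'e set" where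
  "vb_fibre B x \<equiv> vb_preimage B {x}"

definition local_trivialization ::
    "('e, 'm) vector_bundle \<Rightarrow> 'm set \<Rightarrow> ('e \<Rightarrow> 'm \<times> (nat \<Rightarrow> real)) \<Rightarrow> bool" where
  "local_trivialization B U \<psi> \<longleftrightarrow>
     openin (mf_top (vb_base B)) U \<and>
     manifold_diffeomorphism
       (open_submanifold (vb_total B) (vb_preimage B U))
       (product_manifold (open_submanifold (vb_base B) U) (euclidean_manifold (vb_rank B))) \<psi> \<and>
     (\<forall>v \<in> vb_preimage B U. fst (\<psi> v) = vb_proj B v) \<and>
     (\<forall>x\<in>U. \<forall>v \<in> vb_fibre B x. \<forall>w \<in> vb_fibre B x.
        snd (\<psi> (vb_add B v w)) = (\<lambda>i. snd (\<psi> v) i + snd (\<psi> w) i)) \<and>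
     (\<forall>x\<in>U. \<forall>r. \<forall>v \<in> vb_fibre B x. snd (\<psi> (vb_scale B r v)) = (\<lambda>i. r * snd (\<psi> v) i))"

definition smooth_vector_bundle :: "('e, 'm) vector_bundle \<Rightarrow> bool" where
  "smooth_vector_bundle B \<longleftrightarrow>
     smooth_manifold (vb_total B) \<and> smooth_manifold (vb_base B) \<and>
     smooth_manifold_map (vb_total B) (vb_base B) (vb_proj B) \<and>
     vb_proj B ` topspace (mf_top (vb_total B)) = topspace (mf_top (vb_base B)) \<and>
     (\<forall>x \<in> topspace (mf_top (vb_base B)).
        real_vector_space_on (vb_fibre B x) (vb_add B) (vb_scale B)) \<and>
     (\<forall>x \<in> topspace (mf_top (vb_base B)). \<exists>U \<psi>. x \<in> U \<and> local_trivialization B U \<psi>)"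

text \<open>An atlas of local trivializations consists of triples \<open>(U\<^sub>i, \<phi>\<^sub>i, \<psi>\<^sub>i)\<close>.\<close>

definition local_trivialization_atlas ::
    "('e, 'm) vector_bundle \<Rightarrow>
     ('m set \<times> ('m \<Rightarrow> nat \<Rightarrow> real) \<times> ('e \<Rightarrow> 'm \<times> (nat \<Rightarrow> real))) set \<Rightarrow> bool" where
  "local_trivialization_atlas B A \<longleftrightarrow>
     (\<Union>(U, \<phi>, \<psi>) \<in> A. U) = topspace (mf_top (vb_base B)) \<and>
     (\<forall>(U, \<phi>, \<psi>) \<in> A.
        openin (mf_top (vb_base B)) U \<and>
        manifold_diffeomorphism (open_submanifold (vb_base B) U)
          (euclidean_manifold (mf_dim (vb_base B))) \<phi> \<and>
        local_trivialization B U \<psi>)"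

text \<open>
  Points of the dual bundle are pairs \<open>(x, \<xi>)\<close> with \<open>\<xi>\<close> a linear functional on the fibre over \<open>x\<close>.
  A chart \<open>(W, \<phi>)\<close> of the base and a local trivialization \<open>(U, \<psi>)\<close>, giving the local frame
  \<open>\<psi>\<^sup>-\<^sup>1(x, e\<^sub>j)\<close>, induce the chart \<open>(x, \<xi>) \<mapsto> (\<phi> x, (\<xi> (\<psi>\<^sup>-\<^sup>1(x, e\<^sub>j)))\<^sub>j)\<close> over \<open>U \<inter> W\<close>. All local
  trivializations are used, hence the structure involves no choice; its topology is the one
  generated by the inverse images of open sets under these charts.
\<close>

definition dual_bundle_points :: "('e, 'm) vector_bundle \<Rightarrow> ('m \<times> ('e \<Rightarrow> real)) set" where
  "dual_bundle_points B =
     {(x, \<xi>). x \<in> topspace (mf_top (vb_base B)) \<and>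
              \<xi> \<in> linear_functionals (vb_fibre B x) (vb_add B) (vb_scale B)}"

definition dual_bundle_chart ::
    "('e, 'm) vector_bundle \<Rightarrow> 'm set \<Rightarrow> ('m \<Rightarrow> nat \<Rightarrow> real) \<Rightarrow> ('e \<Rightarrow> 'm \<times> (nat \<Rightarrow> real)) \<Rightarrow>
     'm \<times> ('e \<Rightarrow> real) \<Rightarrow> nat \<Rightarrow> real" where
  "dual_bundle_chart B U \<phi> \<psi> = (\<lambda>(x, \<xi>).
     join_coords (mf_dim (vb_base B)) (\<phi> x)
       (\<lambda>j. if j < vb_rank B
            then \<xi> (inv_into (vb_preimage B U) \<psi> (x, \<lambda>i. if i = j then 1 else 0)) else 0))"

definition dual_bundle_atlas ::
    "('e, 'm) vector_bundle \<Rightarrow>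
     (('m \<times> ('e \<Rightarrow> real)) set \<times> ('m \<times> ('e \<Rightarrow> real) \<Rightarrow> nat \<Rightarrow> real)) set" where
  "dual_bundle_atlas B =
     {({v \<in> dual_bundle_points B. fst v \<in> U \<inter> W}, dual_bundle_chart B U \<phi> \<psi>) | U W \<phi> \<psi>.
        (W, \<phi>) \<in> mf_atlas (vb_base B) \<and> local_trivialization B U \<psi>}"

definition dual_bundle :: "('e, 'm) vector_bundle \<Rightarrow> ('m \<times> ('e \<Rightarrow> real), 'm) vector_bundle" where
  "dual_bundle B =
     \<lparr> vb_total =
         \<lparr> mf_top = topology_generated_by
             {{v \<in> D. \<kappa> v \<in> Q} | D \<kappa> Q. (D, \<kappa>) \<in> dual_bundle_atlas B \<and>
                openin (Euclidean_space (mf_dim (vb_base B) + vb_rank B)) Q},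
           mf_dim = mf_dim (vb_base B) + vb_rank B,
           mf_atlas = dual_bundle_atlas B \<rparr>,
       vb_base = vb_base B,
       vb_proj = fst,
       vb_add = (\<lambda>(x, \<xi>) (y, \<eta>). (x, restrict (\<lambda>v. \<xi> v + \<eta> v) (vb_fibre B x))),
       vb_scale = (\<lambda>r (x, \<xi>). (x, restrict (\<lambda>v. r * \<xi> v) (vb_fibre B x))),
       vb_rank = vb_rank B \<rparr>"


section \<open>Diffeological spaces\<close>

text \<open>
  \<open>df_plot X d U p\<close> says that \<open>p\<close>, restricted to the open subset \<open>U\<close> of \<open>\<real>\<^sup>d\<close>, is a plot of \<open>X\<close>;
  the values of \<open>p\<close> off \<open>U\<close> are irrelevant, which is the second axiom below.
\<close>

record 'a diffeological =
  df_points :: "'a set"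
  df_plot :: "nat \<Rightarrow> (nat \<Rightarrow> real) set \<Rightarrow> ((nat \<Rightarrow> real) \<Rightarrow> 'a) \<Rightarrow> bool"

definition diffeological_space :: "'a diffeological \<Rightarrow> bool" where
  "diffeological_space X \<longleftrightarrow>
     (\<forall>d U p. df_plot X d U p \<longrightarrow> openin (Euclidean_space d) U \<and> p \<in> U \<rightarrow> df_points X) \<and>
     (\<forall>d U p p'. df_plot X d U p \<longrightarrow> (\<forall>u\<in>U. p u = p' u) \<longrightarrow> df_plot X d U p') \<and>
     (\<forall>d U. \<forall>x \<in> df_points X. openin (Euclidean_space d) U \<longrightarrow> df_plot X d U (\<lambda>_. x)) \<and>
     (\<forall>d U p d' U' f. df_plot X d U p \<longrightarrow> smooth_between d' d U' f \<longrightarrow> f \<in> U' \<rightarrow> U \<longrightarrow>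
        df_plot X d' U' (p \<circ> f)) \<and>
     (\<forall>d U p. openin (Euclidean_space d) U \<longrightarrow>
        (\<forall>u\<in>U. \<exists>W. u \<in> W \<and> W \<subseteq> U \<and> df_plot X d W p) \<longrightarrow> df_plot X d U p)"

definition diffeologically_smooth ::
    "'a diffeological \<Rightarrow> 'b diffeological \<Rightarrow> ('a \<Rightarrow> 'b) \<Rightarrow> bool" where
  "diffeologically_smooth X Y f \<longleftrightarrow>
     f \<in> df_points X \<rightarrow> df_points Y \<and>
     (\<forall>d U p. df_plot X d U p \<longrightarrow> df_plot Y d U (f \<circ> p))"

definition diffeomorphism :: "'a diffeological \<Rightarrow> 'b diffeological \<Rightarrow> ('a \<Rightarrow> 'b) \<Rightarrow> bool" where
  "diffeomorphism X Y f \<longleftrightarrow>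
     diffeological_space X \<and> diffeological_space Y \<and>
     bij_betw f (df_points X) (df_points Y) \<and>
     diffeologically_smooth X Y f \<and>
     diffeologically_smooth Y X (inv_into (df_points X) f)"

definition subset_diffeology :: "'a diffeological \<Rightarrow> 'a set \<Rightarrow> 'a diffeological" where
  "subset_diffeology X S =
     \<lparr> df_points = df_points X \<inter> S, df_plot = (\<lambda>d U p. df_plot X d U p \<and> p \<in> U \<rightarrow> S) \<rparr>"

definition standard_diffeology :: "'a manifold \<Rightarrow> 'a diffeological" where
  "standard_diffeology M =
     \<lparr> df_points = topspace (mf_top M),
       df_plot = (\<lambda>d U p. openin (Euclidean_space d) U \<and>
                    smooth_manifold_map (open_submanifold (euclidean_manifold d) U) M p) \<rparr>"


section \<open>Pseudo-bundles and the diffeological dual\<close>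

record ('v, 'x) pseudo_bundle =
  pb_total :: "'v diffeological"
  pb_base :: "'x diffeological"
  pb_proj :: "'v \<Rightarrow> 'x"
  pb_add :: "'v \<Rightarrow> 'v \<Rightarrow> 'v"
  pb_scale :: "real \<Rightarrow> 'v \<Rightarrow> 'v"

definition standard_pseudo_bundle :: "('e, 'm) vector_bundle \<Rightarrow> ('e, 'm) pseudo_bundle" where
  "standard_pseudo_bundle B =
     \<lparr> pb_total = standard_diffeology (vb_total B), pb_base = standard_diffeology (vb_base B),
       pb_proj = vb_proj B, pb_add = vb_add B, pb_scale = vb_scale B \<rparr>"

definition pb_fibre :: "('v, 'x) pseudo_bundle \<Rightarrow> 'x \<Rightarrow> 'v set" where
  "pb_fibre P x = {v \<in> df_points (pb_total P). pb_proj P v = x}"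

text \<open>Points of \<open>V\<^sup>*\<close> are pairs \<open>(x, \<xi>)\<close> with \<open>\<xi>\<close> a smooth linear functional on the fibre over \<open>x\<close>.\<close>

definition diff_dual_points :: "('v, 'x) pseudo_bundle \<Rightarrow> ('x \<times> ('v \<Rightarrow> real)) set" where
  "diff_dual_points P =
     {(x, \<xi>). x \<in> df_points (pb_base P) \<and>
              \<xi> \<in> linear_functionals (pb_fibre P x) (pb_add P) (pb_scale P) \<and>
              diffeologically_smooth (subset_diffeology (pb_total P) (pb_fibre P x))
                (standard_diffeology real_manifold) \<xi>}"

text \<open>
  \<open>smooth_pairing P d U p\<close>: for every plot \<open>q : U' \<rightarrow> V\<close> the map \<open>(u, u') \<mapsto> p(u)(q(u'))\<close> is smooth
  on the subset of \<open>U \<times> U'\<close> where \<open>\<pi>\<^sup>*(p(u)) = \<pi>(q(u'))\<close>.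
\<close>

definition smooth_pairing ::
    "('v, 'x) pseudo_bundle \<Rightarrow> nat \<Rightarrow> (nat \<Rightarrow> real) set \<Rightarrow>
     ((nat \<Rightarrow> real) \<Rightarrow> 'x \<times> ('v \<Rightarrow> real)) \<Rightarrow> bool" where
  "smooth_pairing P d U p \<longleftrightarrow>
     (\<forall>d' U' q. df_plot (pb_total P) d' U' q \<longrightarrow>
        diffeologically_smooth
          (subset_diffeology
             (standard_diffeology
                (product_manifold (open_submanifold (euclidean_manifold d) U)
                                  (open_submanifold (euclidean_manifold d') U')))
             {(u, u') \<in> U \<times> U'. fst (p u) = pb_proj P (q u')})
          (standard_diffeology real_manifold)
          (\<lambda>(u, u'). snd (p u) (q u')))"

lemma C_k_zero:
  assumes "openin (Euclidean_space d) U" "\<And>x. x \<in> U \<Longrightarrow> f x = 0"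
  shows "C_k k d U f"
  using assms(2)
proof (induction k arbitrary: f)
  case 0
  have "continuous_on U f \<longleftrightarrow> continuous_on U (\<lambda>_. 0 :: real)"
    by (rule continuous_on_cong) (use 0 in auto)
  then show ?case by simp
next
  case (Suc k)
  obtain S where S: "open S" "U = S \<inter> {x. \<forall>i\<ge>d. x i = 0}"
    using assms(1) by (auto simp: Euclidean_space_def openin_subtopology euclidean_product_topology)
  have "((\<lambda>t. f (x(i := t))) has_real_derivative 0) (at (x i))" if "i < d" "x \<in> U" for i x
  proof -
    have "continuous_on UNIV (\<lambda>t. (x(i := t)) j)" for j
      by (cases "j = i") auto
    then have "continuous_on UNIV (\<lambda>t. x(i := t))"
      by (rule continuous_on_coordinatewise_then_product)
    then have "open ((\<lambda>t. x(i := t)) -` S)"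
      using S(1) by (simp add: continuous_on_open_vimage)
    moreover have "x i \<in> (\<lambda>t. x(i := t)) -` S"
      using that S(2) by simp
    ultimately have "\<forall>\<^sub>F t in nhds (x i). t \<in> (\<lambda>t. x(i := t)) -` S"
      by (rule eventually_nhds_in_open)
    then have "\<forall>\<^sub>F t in nhds (x i). f (x(i := t)) = 0"
      by eventually_elim (use that S(2) Suc.prems in auto)
    then show ?thesis
      by (subst DERIV_cong_ev[OF refl _ refl, where g = "\<lambda>_. 0"]) auto
  qed
  moreover have "continuous_on U f \<longleftrightarrow> continuous_on U (\<lambda>_. 0 :: real)"
    by (rule continuous_on_cong) (use Suc.prems in auto)
  ultimately show ?case
    using Suc.IH by (auto intro!: exI[of _ "\<lambda>_ _. 0"])
qed

lemma smooth_pairing_zero: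
  assumes "\<And>u v. u \<in> U \<Longrightarrow> v \<in> pb_fibre P (fst (p u)) \<Longrightarrow> snd (p u) v = 0"
    and "\<And>d' U' q. df_plot (pb_total P) d' U' q \<Longrightarrow> q \<in> U' \<rightarrow> df_points (pb_total P)"
  shows "smooth_pairing P d U p"
proof -
  have plot_zero: "df_plot (standard_diffeology real_manifold) e W h"
    if W: "openin (Euclidean_space e) W" and h: "\<And>w. w \<in> W \<Longrightarrow> h w = 0" for e W h
  proof -
    have sub: "W \<subseteq> topspace (Euclidean_space e)"
      using W by (rule openin_subset)
    have cont: "continuous_map (subtopology (Euclidean_space e) W) euclideanreal h"
      by (rule continuous_map_eq[where f = "\<lambda>_. 0"]) (use h in auto)
    have inv: "inv_into W id x = x" if "x \<in> W" for x
      using inv_into_f_f[of id W x] that by simp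
    have "smooth_between e 1 W ((\<lambda>t i. if i = 0 then t else 0) \<circ> h \<circ> inv_into W id)"
      using W C_k_zero[OF W] h inv
      by (auto simp: smooth_between_def smooth_real_on_def Euclidean_space_def)
    then show ?thesis
      using W cont sub
      by (auto simp: standard_diffeology_def smooth_manifold_map_def open_submanifold_def
          euclidean_manifold_def real_manifold_def Int_absorb1)
  qed
  show ?thesis
    unfolding smooth_pairing_def diffeologically_smooth_def
  proof (intro allI impI conjI)
    fix d' U' q e W r
    assume q: "df_plot (pb_total P) d' U' q"
      and r: "df_plot (subset_diffeology
             (standard_diffeology
                (product_manifold (open_submanifold (euclidean_manifold d) U)
                                  (open_submanifold (euclidean_manifold d') U')))
             {(u, u') \<in> U \<times> U'. fst (p u) = pb_proj P (q u')}) e W r"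
    show "df_plot (standard_diffeology real_manifold) e W ((\<lambda>(u, u'). snd (p u) (q u')) \<circ> r)"
    proof (rule plot_zero)
      show "openin (Euclidean_space e) W"
        using r by (simp add: subset_diffeology_def standard_diffeology_def)
      fix w assume "w \<in> W"
      then have "r w \<in> {(u, u') \<in> U \<times> U'. fst (p u) = pb_proj P (q u')}"
        using r by (intro funcset_mem[of r W]) (simp_all add: subset_diffeology_def)
      then show "((\<lambda>(u, u'). snd (p u) (q u')) \<circ> r) w = 0"
        using assms(1) assms(2)[OF q] by (fastforce simp: pb_fibre_def)
    qed
  qed (auto simp: standard_diffeology_def real_manifold_def)
qed

text \<open>
  The projection \<open>\<pi>\<^sup>*\<close> of the dual pseudo-bundle has to be smooth, so \<open>\<pi>\<^sup>* \<circ> p\<close> has to be a plot of the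
  base for every plot \<open>p\<close> of \<open>V\<^sup>*\<close>. Smoothness of the pairings alone does not imply this: it holds
  for zero covectors over an arbitrary, even discontinuous, map into the base
  (\<open>smooth_pairing_zero\<close>). Hence the requirement is part of the definition.
\<close>

definition diff_dual :: "('v, 'x) pseudo_bundle \<Rightarrow> ('x \<times> ('v \<Rightarrow> real), 'x) pseudo_bundle" where
  "diff_dual P =
     \<lparr> pb_total =
         \<lparr> df_points = diff_dual_points P,
           df_plot = (\<lambda>d U p. openin (Euclidean_space d) U \<and> p \<in> U \<rightarrow> diff_dual_points P \<and>
                        df_plot (pb_base P) d U (fst \<circ> p) \<and>
                        smooth_pairing P d U p) \<rparr>,
       pb_base = pb_base P,
       pb_proj = fst,
       pb_add = (\<lambda>(x, \<xi>) (y, \<eta>). (x, restrict (\<lambda>v. \<xi> v + \<eta> v) (pb_fibre P x))),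
       pb_scale = (\<lambda>r (x, \<xi>). (x, restrict (\<lambda>v. r * \<xi> v) (pb_fibre P x))) \<rparr>"

end

theory Submission
  imports Defs
begin

text \<open>
  Let \<open>e\<^sub>0, \<dots>, e\<^sub>k\<^sub>-\<^sub>1\<close> be the local frame of a trivialization over \<open>U\<close>. A covector \<open>\<xi>\<close> on the fibre over a
  point of \<open>U\<close> satisfies \<open>\<xi> v = \<Sum>\<^sub>j v\<^sub>j * \<xi> e\<^sub>j\<close> (\<open>linear_functional_frame_expansion\<close>), where the
  coordinates \<open>v\<^sub>j\<close> depend smoothly on \<open>v\<close>. Hence every linear functional on a fibre is smooth, and the
  two dual bundles have the same points (\<open>diff_dual_points_standard_pseudo_bundle\<close>).

  They also have the same plots, because both diffeologies amount to the following condition on a map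
  \<open>p\<close>: the base points of \<open>p\<close> form a plot of \<open>M\<close>, and the coefficients \<open>p(w)(e\<^sub>j)\<close> are smooth in \<open>w\<close> for
  every local frame. For the usual dual bundle this is a reading of its charts (\<open>dual_bundle_plotD\<close>,
  \<open>dual_bundle_plotI\<close>). For the diffeological dual, pairing \<open>p\<close> with the frame along \<open>p\<close> gives the
  coefficients (\<open>smooth_pairing_frame\<close>), and conversely the expansion above writes the pairing with
  any plot through the coefficients (\<open>smooth_pairingI\<close>). So the two diffeological spaces are equal,
  and the identity is the diffeomorphism.

  The argument localizes to charts and composes smooth maps freely. This rests on the calculus of
  \<open>C_k\<close>: functions that are \<open>C\<^sup>k\<close> locally are \<open>C\<^sup>k\<close> (\<open>C_k_local\<close>), and composites of \<open>C\<^sup>k\<close> maps are \<open>C\<^sup>k\<close>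
  (\<open>C_k_compose\<close>), by a chain rule derived from continuity of the partial derivatives
  (\<open>chain_rule_along_curve\<close>). Its consequences for plots are that smooth maps of manifolds preserve
  plots, and that plots of open submanifolds and of products are what one expects.
\<close>

section \<open>Calculus on open sets of coordinate sequences\<close>

lemma subtopology_Euclidean_space:
  assumes "U \<subseteq> topspace (Euclidean_space d)"
  shows "subtopology (Euclidean_space d) U = top_of_set U"
  using assms
  by (simp add: Euclidean_space_def euclidean_product_topology subtopology_subtopology Int_absorb1)

lemma openin_Euclidean_space_imp_vanish:
  assumes "openin (Euclidean_space d) U" "x \<in> U" "d \<le> i"
  shows "x i = 0"
  using openin_subset[OF assms(1)] assms(2,3) by (auto simp: topspace_Euclidean_space)

text \<open>
  The product topology on sequences restricts to the box topology in the first \<open>d\<close> coordinates.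
  All later arguments with limits, coordinate lines and mean values take place inside such a box.
\<close>

lemma openin_Euclidean_space_box:
  assumes "openin (Euclidean_space d) U" "x \<in> U"
  obtains e where "e > 0"
    "\<And>y. (\<And>i. i < d \<Longrightarrow> \<bar>y i - x i\<bar> < e) \<Longrightarrow> (\<And>i. d \<le> i \<Longrightarrow> y i = 0) \<Longrightarrow> y \<in> U"
proof -
  obtain S where S: "openin (powertop_real UNIV) S" "U = S \<inter> {x. \<forall>i\<ge>d. x i = 0}"
    using assms(1) by (auto simp: Euclidean_space_def openin_subtopology)
  obtain X where X: "x \<in> (\<Pi>\<^sub>E i\<in>UNIV. X i)" "\<And>i. open (X i)" "(\<Pi>\<^sub>E i\<in>UNIV. X i) \<subseteq> S"
    using product_topology_open_contains_basis[OF S(1), of x] assms(2) S(2) by auto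
  have "\<forall>\<^sub>F e in at_right 0. ball (x i) e \<subseteq> X i" for i
  proof -
    have "x i \<in> X i"
      using X(1) by auto
    then obtain r where r: "r > 0" "ball (x i) r \<subseteq> X i"
      using X(2)[of i] open_contains_ball by blast
    have "ball (x i) e \<subseteq> X i" if "e < r" for e
      using r(2) subset_ball[of e r "x i"] that by simp
    then show ?thesis
      using r(1) unfolding eventually_at_right_field by blast
  qed
  then have "\<forall>\<^sub>F e in at_right 0. e > 0 \<and> (\<forall>i\<in>{..<d}. ball (x i) e \<subseteq> X i)"
    by (intro eventually_conj eventually_at_right_less eventually_ball_finite) auto
  then obtain e where e: "e > 0" "\<And>i. i < d \<Longrightarrow> ball (x i) e \<subseteq> X i"
    using eventually_happens'[OF trivial_limit_at_right_real] by (metis (lifting) lessThan_iff)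
  have "y \<in> U" if y: "\<And>i. i < d \<Longrightarrow> \<bar>y i - x i\<bar> < e" "\<And>i. d \<le> i \<Longrightarrow> y i = 0" for y
  proof -
    have "y i \<in> X i" for i
    proof (cases "i < d")
      case True
      then show ?thesis
        using y(1)[OF True] by (intro subsetD[OF e(2)[OF True]]) (simp add: dist_real_def abs_minus_commute)
    next
      case False
      then have "y i = x i"
        using y(2)[of i] openin_Euclidean_space_imp_vanish[OF assms] by simp
      then show ?thesis
        using X(1) by auto
    qed
    then show ?thesis
      using X(3) S(2) y(2) by (auto simp: PiE_UNIV_domain)
  qed
  with e(1) show thesis
    by (rule that)
qed

lemma eventually_coordinate_line_in:
  assumes "openin (Euclidean_space d) U" "x \<in> U" "i < d"
  shows "\<forall>\<^sub>F t in nhds (x i). x(i := t) \<in> U"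
proof -
  obtain e where e: "e > 0"
    "\<And>y. (\<And>i. i < d \<Longrightarrow> \<bar>y i - x i\<bar> < e) \<Longrightarrow> (\<And>i. d \<le> i \<Longrightarrow> y i = 0) \<Longrightarrow> y \<in> U"
    using openin_Euclidean_space_box[OF assms(1,2)] by blast
  have "\<forall>\<^sub>F t in nhds (x i). dist t (x i) < e"
    using e(1) eventually_nhds_metric by blast
  then show ?thesis
  proof eventually_elim
    case (elim t)
    then show ?case
      using openin_Euclidean_space_imp_vanish[OF assms(1,2)] assms(3) e(1)
      by (intro e(2)) (auto simp: dist_real_def)
  qed
qed

lemma C_k_imp_continuous_on: "C_k k d U f \<Longrightarrow> continuous_on U f"
  by (cases k) auto

lemma C_k_SucE:
  assumes "C_k (Suc k) d U f"
  obtains f' where "continuous_on U f" "\<And>i. i < d \<Longrightarrow> C_k k d U (f' i)"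
    "\<And>i x. i < d \<Longrightarrow> x \<in> U \<Longrightarrow> ((\<lambda>t. f (x(i := t))) has_real_derivative f' i x) (at (x i))"
  using assms unfolding C_k.simps by blast

lemma C_k_SucI:
  assumes "continuous_on U f" "\<And>i. i < d \<Longrightarrow> C_k k d U (f' i)"
    "\<And>i x. i < d \<Longrightarrow> x \<in> U \<Longrightarrow> ((\<lambda>t. f (x(i := t))) has_real_derivative f' i x) (at (x i))"
  shows "C_k (Suc k) d U f"
  using assms unfolding C_k.simps by blast

lemma C_k_SucD: "C_k (Suc k) d U f \<Longrightarrow> C_k k d U f"
proof (induction k arbitrary: f)
  case (Suc k)
  from Suc.prems obtain g where g: "continuous_on U f" "\<And>i. i < d \<Longrightarrow> C_k (Suc k) d U (g i)"
    "\<And>i x. i < d \<Longrightarrow> x \<in> U \<Longrightarrow> ((\<lambda>t. f (x(i := t))) has_real_derivative g i x) (at (x i))"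
    by (rule C_k_SucE) blast
  show ?case
    using g(1) Suc.IH[OF g(2)] g(3) by (rule C_k_SucI)
qed simp

lemma C_k_cong:
  assumes U: "openin (Euclidean_space d) U" and eq: "\<And>x. x \<in> U \<Longrightarrow> f x = g x"
    and f: "C_k k d U f"
  shows "C_k k d U g"
proof -
  have cont: "continuous_on U g"
    using C_k_imp_continuous_on[OF f] eq by (simp cong: continuous_on_cong)
  show ?thesis
  proof (cases k)
    case (Suc l)
    obtain f' where f': "\<And>i. i < d \<Longrightarrow> C_k l d U (f' i)"
      "\<And>i x. i < d \<Longrightarrow> x \<in> U \<Longrightarrow> ((\<lambda>t. f (x(i := t))) has_real_derivative f' i x) (at (x i))"
      using f unfolding Suc by (rule C_k_SucE) blast
    have "((\<lambda>t. g (x(i := t))) has_real_derivative f' i x) (at (x i))" if "i < d" "x \<in> U" for i x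
    proof -
      have "\<forall>\<^sub>F t in nhds (x i). f (x(i := t)) = g (x(i := t))"
        using eventually_coordinate_line_in[OF U that(2,1)] by eventually_elim (rule eq)
      from DERIV_cong_ev[OF refl this refl] show ?thesis
        using f'(2)[OF that] by blast
    qed
    with cont f'(1) show ?thesis
      unfolding Suc by (rule C_k_SucI)
  qed (use cont in simp)
qed

lemma C_k_mono:
  assumes "W \<subseteq> U" "C_k k d U f"
  shows "C_k k d W f"
  using assms(2)
proof (induction k arbitrary: f)
  case 0
  then show ?case
    using continuous_on_subset[OF _ assms(1)] by simp
next
  case (Suc k)
  obtain g where g: "continuous_on U f" "\<And>i. i < d \<Longrightarrow> C_k k d U (g i)"
    "\<And>i x. i < d \<Longrightarrow> x \<in> U \<Longrightarrow> ((\<lambda>t. f (x(i := t))) has_real_derivative g i x) (at (x i))"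
    using Suc.prems by (rule C_k_SucE) blast
  show ?case
    using continuous_on_subset[OF g(1) assms(1)] Suc.IH[OF g(2)] g(3)[OF _ subsetD[OF assms(1)]]
    by (rule C_k_SucI)
qed

lemma continuous_on_openin_local:
  fixes U :: "(nat \<Rightarrow> real) set" and f :: "(nat \<Rightarrow> real) \<Rightarrow> real"
  assumes "\<And>x. x \<in> U \<Longrightarrow> \<exists>W. openin (top_of_set U) W \<and> x \<in> W \<and> continuous_on W f"
  shows "continuous_on U f"
  unfolding continuous_on_eq_continuous_within
proof
  fix x assume x: "x \<in> U"
  then obtain W where W: "openin (top_of_set U) W" "x \<in> W" "continuous_on W f"
    using assms by blast
  then obtain S where S: "open S" "W = U \<inter> S"
    by (auto simp: openin_open)
  have "at x within U = at x within W"
    by (rule at_within_nhd[of x S]) (use S W in auto)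
  then show "continuous (at x within U) f"
    using W(2,3) by (simp add: continuous_on_eq_continuous_within continuous_within)
qed

text \<open>Partial derivatives are unique, so the ones witnessing differentiability on small open sets
  agree with \<open>deriv\<close> along coordinate lines and glue to a witness on the union.\<close>

lemma C_k_local:
  assumes U: "openin (Euclidean_space d) U"
    and loc: "\<And>x. x \<in> U \<Longrightarrow> \<exists>W. openin (Euclidean_space d) W \<and> x \<in> W \<and> W \<subseteq> U \<and> C_k k d W f"
  shows "C_k k d U f"
  using loc
proof (induction k arbitrary: f)
  case (0 f)
  show ?case
    unfolding C_k.simps
  proof (rule continuous_on_openin_local)
    fix x assume "x \<in> U"
    then obtain W where W: "openin (Euclidean_space d) W" "x \<in> W" "W \<subseteq> U" "continuous_on W f"
      using 0 unfolding C_k.simps by blast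
    have "openin (top_of_set U) W"
      using openin_open_subtopology[OF U, of W] W(1,3)
      by (simp only: subtopology_Euclidean_space[OF openin_subset[OF U]])
    with W show "\<exists>W. openin (top_of_set U) W \<and> x \<in> W \<and> continuous_on W f"
      by blast
  qed
next
  case (Suc k f)
  define g where "g i x = deriv (\<lambda>t. f (x(i := t))) (x i)" for i x
  have *: "\<exists>W. openin (Euclidean_space d) W \<and> x \<in> W \<and> W \<subseteq> U \<and> continuous_on W f \<and>
      (\<forall>i<d. C_k k d W (g i) \<and>
        (\<forall>y\<in>W. ((\<lambda>t. f (y(i := t))) has_real_derivative g i y) (at (y i))))"
    if x: "x \<in> U" for x
  proof -
    obtain W h where W: "openin (Euclidean_space d) W" "x \<in> W" "W \<subseteq> U" "continuous_on W f"
      and h: "\<And>i. i < d \<Longrightarrow> C_k k d W (h i)"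
      "\<And>i y. i < d \<Longrightarrow> y \<in> W \<Longrightarrow> ((\<lambda>t. f (y(i := t))) has_real_derivative h i y) (at (y i))"
    proof -
      obtain W where W: "openin (Euclidean_space d) W" "x \<in> W" "W \<subseteq> U" "C_k (Suc k) d W f"
        using Suc.prems[OF x] by blast
      obtain h where "continuous_on W f" "\<And>i. i < d \<Longrightarrow> C_k k d W (h i)"
        "\<And>i y. i < d \<Longrightarrow> y \<in> W \<Longrightarrow> ((\<lambda>t. f (y(i := t))) has_real_derivative h i y) (at (y i))"
        using W(4) by (rule C_k_SucE) blast
      with W(1-3) show thesis
        by (rule that)
    qed
    have eq: "h i y = g i y" if "i < d" "y \<in> W" for i y
      unfolding g_def by (rule DERIV_imp_deriv[OF h(2)[OF that], symmetric])
    have "C_k k d W (g i)" if "i < d" for i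
      by (rule C_k_cong[OF W(1) eq[OF that] h(1)[OF that]])
    moreover have "((\<lambda>t. f (y(i := t))) has_real_derivative g i y) (at (y i))"
      if "i < d" "y \<in> W" for i y
      using h(2)[OF that] eq[OF that] by simp
    ultimately show ?thesis
      using W by (intro exI[of _ W] conjI allI impI ballI)
  qed
  have "\<exists>W. openin (Euclidean_space d) W \<and> x \<in> W \<and> W \<subseteq> U \<and> C_k k d W f" if "x \<in> U" for x
    using Suc.prems[OF that] by (elim ex_forward conjE) (intro conjI, assumption+, rule C_k_SucD)
  then have "C_k k d U f"
    by (rule Suc.IH)
  moreover have "C_k k d U (g i)" if "i < d" for i
  proof (rule Suc.IH)
    fix x assume "x \<in> U"
    from *[OF this] show "\<exists>W. openin (Euclidean_space d) W \<and> x \<in> W \<and> W \<subseteq> U \<and> C_k k d W (g i)"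
      using that by (elim ex_forward conjE) simp
  qed
  moreover have "((\<lambda>t. f (y(i := t))) has_real_derivative g i y) (at (y i))"
    if i: "i < d" and y: "y \<in> U" for i y
  proof -
    obtain W where "y \<in> W" "\<forall>i<d. C_k k d W (g i) \<and>
        (\<forall>y\<in>W. ((\<lambda>t. f (y(i := t))) has_real_derivative g i y) (at (y i)))"
      using *[OF y] by (elim exE conjE)
    then show ?thesis
      using i by simp
  qed
  ultimately show ?case
    by (rule C_k_SucI[OF C_k_imp_continuous_on])
qed

lemma C_k_const: "C_k k d U (\<lambda>_. c)"
proof (induction k arbitrary: c)
  case (Suc k)
  have "\<forall>i<d. C_k k d U (\<lambda>_. 0) \<and> (\<forall>x\<in>U. ((\<lambda>t. c) has_real_derivative 0) (at (x i)))"
    using Suc by auto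
  then show ?case
    unfolding C_k.simps by (intro conjI continuous_on_const exI[of _ "\<lambda>_ _. 0"])
qed simp

lemma C_k_coordinate: "C_k k d U (\<lambda>x. x j)"
proof (cases k)
  case (Suc l)
  have "((\<lambda>t. (x(i := t)) j) has_real_derivative (if i = j then 1 else 0)) (at (x i))"
    for x :: "nat \<Rightarrow> real" and i
    by (cases "i = j") auto
  then have "\<forall>i<d. C_k l d U (\<lambda>_. if i = j then 1 else 0) \<and>
      (\<forall>x\<in>U. ((\<lambda>t. (x(i := t)) j) has_real_derivative (if i = j then 1 else 0)) (at (x i)))"
    using C_k_const by blast
  then show ?thesis
    unfolding Suc C_k.simps
    by (intro conjI continuous_on_product_then_coordinatewise[OF continuous_on_id]
        exI[of _ "\<lambda>i _. if i = j then 1 else 0"])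
qed (simp add: continuous_on_product_then_coordinatewise[OF continuous_on_id])

lemma C_k_add:
  assumes "C_k k d U f" "C_k k d U g"
  shows "C_k k d U (\<lambda>x. f x + g x)"
  using assms
proof (induction k arbitrary: f g)
  case 0
  then show ?case by (auto intro: continuous_on_add)
next
  case (Suc k)
  obtain f' where f': "continuous_on U f" "\<And>i. i < d \<Longrightarrow> C_k k d U (f' i)"
    "\<And>i x. i < d \<Longrightarrow> x \<in> U \<Longrightarrow> ((\<lambda>t. f (x(i := t))) has_real_derivative f' i x) (at (x i))"
    using Suc.prems(1) by (rule C_k_SucE) blast
  obtain g' where g': "continuous_on U g" "\<And>i. i < d \<Longrightarrow> C_k k d U (g' i)"
    "\<And>i x. i < d \<Longrightarrow> x \<in> U \<Longrightarrow> ((\<lambda>t. g (x(i := t))) has_real_derivative g' i x) (at (x i))"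
    using Suc.prems(2) by (rule C_k_SucE) blast
  show ?case
    unfolding C_k.simps
    by (intro conjI exI[of _ "\<lambda>i x. f' i x + g' i x"] allI impI ballI)
      (use f' g' in \<open>auto intro!: Suc.IH DERIV_add continuous_on_add\<close>)
qed

lemma C_k_mult:
  assumes "C_k k d U f" "C_k k d U g"
  shows "C_k k d U (\<lambda>x. f x * g x)"
  using assms
proof (induction k arbitrary: f g)
  case 0
  then show ?case by (auto intro: continuous_on_mult)
next
  case (Suc k)
  obtain f' where f': "continuous_on U f" "\<And>i. i < d \<Longrightarrow> C_k k d U (f' i)"
    "\<And>i x. i < d \<Longrightarrow> x \<in> U \<Longrightarrow> ((\<lambda>t. f (x(i := t))) has_real_derivative f' i x) (at (x i))"
    using Suc.prems(1) by (rule C_k_SucE) blast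
  obtain g' where g': "continuous_on U g" "\<And>i. i < d \<Longrightarrow> C_k k d U (g' i)"
    "\<And>i x. i < d \<Longrightarrow> x \<in> U \<Longrightarrow> ((\<lambda>t. g (x(i := t))) has_real_derivative g' i x) (at (x i))"
    using Suc.prems(2) by (rule C_k_SucE) blast
  have "C_k k d U (\<lambda>x. f' i x * g x + g' i x * f x)" if "i < d" for i
    using f'(2) g'(2) C_k_SucD[OF Suc.prems(1)] C_k_SucD[OF Suc.prems(2)] that
    by (intro C_k_add Suc.IH) auto
  moreover have "((\<lambda>t. f (x(i := t)) * g (x(i := t))) has_real_derivative
      f' i x * g x + g' i x * f x) (at (x i))" if "i < d" "x \<in> U" for i x
    using DERIV_mult[OF f'(3)[OF that] g'(3)[OF that]] by simp
  ultimately show ?case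
    unfolding C_k.simps
    by (intro conjI exI[of _ "\<lambda>i x. f' i x * g x + g' i x * f x"] continuous_on_mult f'(1) g'(1))
      blast
qed

lemma C_k_sum:
  assumes "finite I" "\<And>j. j \<in> I \<Longrightarrow> C_k k d U (f j)"
  shows "C_k k d U (\<lambda>x. \<Sum>j\<in>I. f j x)"
  using assms by (induction I rule: finite_induct) (auto intro: C_k_const C_k_add)

lemma mean_value_between:
  fixes f :: "real \<Rightarrow> real"
  assumes "\<And>s. min a b \<le> s \<Longrightarrow> s \<le> max a b \<Longrightarrow> (f has_real_derivative f' s) (at s)"
  shows "\<exists>s. min a b \<le> s \<and> s \<le> max a b \<and> f b - f a = (b - a) * f' s"
proof (cases a b rule: linorder_cases)
  case less
  then obtain s where "a < s" "s < b" "f b - f a = (b - a) * f' s"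
    using MVT2[of a b f f'] assms by (auto simp: min_def max_def)
  then show ?thesis
    using less by (intro exI[of _ s]) (auto simp: algebra_simps)
next
  case greater
  then obtain s where "b < s" "s < a" "f a - f b = (a - b) * f' s"
    using MVT2[of b a f f'] assms by (auto simp: min_def max_def)
  then show ?thesis
    using greater by (intro exI[of _ s]) (auto simp: algebra_simps)
qed auto

text \<open>
  The chain rule for a curve \<open>c\<close> in \<open>V\<close>, under continuity of the partial derivatives of \<open>g\<close>. The
  increment \<open>g (c t) - g (c t\<^sub>0)\<close> telescopes over the points \<open>z n t\<close> whose first \<open>n\<close> coordinates are
  those of \<open>c t\<close> and whose other coordinates are those of \<open>c t\<^sub>0\<close>. Consecutive points differ in one
  coordinate, so the mean value theorem writes the \<open>n\<close>-th increment as \<open>(c t n - c t\<^sub>0 n) * G t\<close>,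
  where \<open>G t\<close> tends to the partial derivative at \<open>c t\<^sub>0\<close>.
\<close>

lemma chain_rule_along_curve:
  fixes c :: "real \<Rightarrow> nat \<Rightarrow> real"
  assumes V: "openin (Euclidean_space m) V"
    and cont: "\<And>j. j < m \<Longrightarrow> continuous_on V (g' j)"
    and g: "\<And>j y. j < m \<Longrightarrow> y \<in> V \<Longrightarrow>
      ((\<lambda>t. g (y(j := t))) has_real_derivative g' j y) (at (y j))"
    and c0: "c t0 \<in> V" and cV: "\<forall>\<^sub>F t in nhds t0. c t \<in> V"
    and c: "\<And>j. j < m \<Longrightarrow> ((\<lambda>t. c t j) has_real_derivative c' j) (at t0)"
  shows "((\<lambda>t. g (c t)) has_real_derivative (\<Sum>j<m. g' j (c t0) * c' j)) (at t0)"
proof -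
  define z where "z n t = (\<lambda>i. if i < n then c t i else c t0 i)" for n :: nat and t
  have "((\<lambda>t. g (z n t)) has_real_derivative (\<Sum>j<n. g' j (c t0) * c' j)) (at t0)"
    if "n \<le> m" for n
    using that
  proof (induction n)
    case 0
    then show ?case by (simp add: z_def)
  next
    case (Suc n)
    then have n: "n < m" by simp
    define L where "L = g' n (c t0)"
    define D where "D t = g (z (Suc n) t) - g (z n t)" for t
    define G where "G t = (if c t n = c t0 n then L else D t / (c t n - c t0 n))" for t
    have z_Suc: "z (Suc n) t = (z n t)(n := c t n)" and z_n: "z n t = (z n t)(n := c t0 n)" for t
      by (auto simp: z_def fun_eq_iff less_Suc_eq)
    have D_eq: "D t = (c t n - c t0 n) * G t" for t
      by (cases "c t n = c t0 n") (use z_Suc[of t] z_n[of t] in \<open>simp_all add: G_def D_def\<close>)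
    have "(G \<longlongrightarrow> L) (at t0)"
    proof (rule tendstoI)
      fix \<epsilon> :: real assume \<epsilon>: "\<epsilon> > 0"
      define N where "N = {y \<in> V. dist (g' n y) L < \<epsilon>}"
      have "openin (Euclidean_space m) N"
      proof -
        have "openin (top_of_set V) (V \<inter> g' n -` ball L \<epsilon>)"
          by (rule continuous_openin_preimage_gen[OF cont[OF n]]) simp
        moreover have "V \<inter> g' n -` ball L \<epsilon> = N"
          by (auto simp: N_def dist_commute)
        ultimately show ?thesis
          using openin_trans_full[of "Euclidean_space m" V] V
          by (simp add: subtopology_Euclidean_space[OF openin_subset[OF V]])
      qed
      moreover have "c t0 \<in> N"
        using c0 \<epsilon> by (simp add: N_def L_def)
      ultimately obtain e where e: "e > 0"
        "\<And>y. (\<And>i. i < m \<Longrightarrow> \<bar>y i - c t0 i\<bar> < e) \<Longrightarrow> (\<And>i. m \<le> i \<Longrightarrow> y i = 0) \<Longrightarrow>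
          y \<in> N"
        by (rule openin_Euclidean_space_box) blast
      have "\<forall>\<^sub>F t in at t0. \<forall>i\<in>{..<m}. \<bar>c t i - c t0 i\<bar> < e"
      proof (rule eventually_ball_finite, simp, rule ballI)
        fix i assume "i \<in> {..<m}"
        then have "isCont (\<lambda>t. c t i) t0"
          using c DERIV_isCont by blast
        then have lim: "((\<lambda>t. c t i) \<longlongrightarrow> c t0 i) (at t0)"
          by (simp add: isCont_def)
        show "\<forall>\<^sub>F t in at t0. \<bar>c t i - c t0 i\<bar> < e"
          using tendstoD[OF lim e(1)] by (simp add: dist_real_def)
      qed
      then show "\<forall>\<^sub>F t in at t0. dist (G t) L < \<epsilon>"
      proof eventually_elim
        case (elim t)
        have in_N: "(z n t)(n := s) \<in> N"
          if "min (c t0 n) (c t n) \<le> s" "s \<le> max (c t0 n) (c t n)" for s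
        proof (rule e(2))
          have "\<bar>s - c t0 n\<bar> < e"
            using that bspec[OF elim, of n] n by (auto simp: min_def max_def split: if_splits)
          then show "\<bar>((z n t)(n := s)) i - c t0 i\<bar> < e" if "i < m" for i
            using that elim e(1) by (auto simp: z_def)
          show "((z n t)(n := s)) i = 0" if "m \<le> i" for i
            using that n openin_Euclidean_space_imp_vanish[OF V c0] by (auto simp: z_def)
        qed
        have "((\<lambda>s. g ((z n t)(n := s))) has_real_derivative g' n ((z n t)(n := s))) (at s)"
          if "min (c t0 n) (c t n) \<le> s" "s \<le> max (c t0 n) (c t n)" for s
          using g[OF n, of "(z n t)(n := s)"] in_N[OF that] by (simp add: N_def)
        from mean_value_between[OF this] obtain s
          where s: "min (c t0 n) (c t n) \<le> s" "s \<le> max (c t0 n) (c t n)"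
            and "g ((z n t)(n := c t n)) - g ((z n t)(n := c t0 n)) =
              (c t n - c t0 n) * g' n ((z n t)(n := s))"
          by blast
        then have "D t = (c t n - c t0 n) * g' n ((z n t)(n := s))"
          using z_Suc[of t] z_n[of t] by (simp add: D_def)
        then show ?case
          using in_N[OF s] \<epsilon> by (auto simp: G_def N_def)
      qed
    qed
    moreover have "((\<lambda>t. (c t n - c t0 n) / (t - t0)) \<longlongrightarrow> c' n) (at t0)"
      using c[OF n] by (simp add: has_field_derivative_iff)
    ultimately have "((\<lambda>t. (c t n - c t0 n) / (t - t0) * G t) \<longlongrightarrow> c' n * L) (at t0)"
      by (intro tendsto_mult)
    moreover have "(D t - D t0) / (t - t0) = (c t n - c t0 n) / (t - t0) * G t" for t
      using D_eq[of t] D_eq[of t0] by simp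
    ultimately have "((\<lambda>t. (D t - D t0) / (t - t0)) \<longlongrightarrow> c' n * L) (at t0)"
      by (simp only:)
    then have "(D has_real_derivative L * c' n) (at t0)"
      by (subst mult.commute) (simp only: has_field_derivative_iff)
    from DERIV_add[OF Suc.IH this] n show ?case
      by (simp add: D_def L_def)
  qed
  from this[of m] have "((\<lambda>t. g (z m t)) has_real_derivative (\<Sum>j<m. g' j (c t0) * c' j)) (at t0)"
    by simp
  moreover have ev: "\<forall>\<^sub>F t in nhds t0. g (z m t) = g (c t)"
    using cV
  proof eventually_elim
    case (elim t)
    have "z m t i = c t i" for i
      using openin_Euclidean_space_imp_vanish[OF V elim, of i]
        openin_Euclidean_space_imp_vanish[OF V c0, of i] by (simp add: z_def)
    then have "z m t = c t" ..
    then show ?case by simp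
  qed
  ultimately show ?thesis
    using DERIV_cong_ev[OF refl ev refl] by blast
qed

text \<open>
  The partial derivatives of the composite are \<open>\<Sum>\<^sub>j (\<partial>\<^sub>j g \<circ> f) * \<partial>\<^sub>i f\<^sub>j\<close>. They are of class \<open>C\<^sup>k\<close> by
  induction, since they involve only \<open>C\<^sup>k\<close> functions and a composite with a \<open>C\<^sup>k\<close> outer function.
\<close>

lemma C_k_compose:
  assumes U: "openin (Euclidean_space d) U" and V: "openin (Euclidean_space m) V"
    and fV: "f \<in> U \<rightarrow> V" and f: "\<And>j. j < m \<Longrightarrow> C_k k d U (\<lambda>x. f x j)" and g: "C_k k m V g"
  shows "C_k k d U (\<lambda>x. g (f x))"
proof -
  have cont: "continuous_on U (\<lambda>x. g (f x))"
    if "\<And>j. j < m \<Longrightarrow> C_k l d U (\<lambda>x. f x j)" "C_k l m V g" for l g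
  proof (rule continuous_on_compose2[OF C_k_imp_continuous_on[OF that(2)]])
    show "f ` U \<subseteq> V" using fV by auto
    show "continuous_on U f"
    proof (rule continuous_on_coordinatewise_then_product)
      fix j
      show "continuous_on U (\<lambda>x. f x j)"
      proof (cases "j < m")
        case True
        then show ?thesis
          using that(1) C_k_imp_continuous_on by blast
      next
        case False
        then have "f x j = 0" if "x \<in> U" for x
          using openin_Euclidean_space_imp_vanish[OF V funcset_mem[OF fV that]] by simp
        then show ?thesis
          by (simp cong: continuous_on_cong)
      qed
    qed
  qed
  show ?thesis
    using f g
  proof (induction k arbitrary: g)
    case 0
    then show ?case
      using cont[of 0 g] by simp
  next
    case (Suc k)
    have "\<exists>h. j < m \<longrightarrow> (\<forall>i<d. C_k k d U (h i) \<and>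
        (\<forall>x\<in>U. ((\<lambda>t. f (x(i := t)) j) has_real_derivative h i x) (at (x i))))" for j
      using Suc.prems(1)[of j] unfolding C_k.simps by blast
    then have "\<exists>f'. \<forall>j. j < m \<longrightarrow> (\<forall>i<d. C_k k d U (f' j i) \<and>
        (\<forall>x\<in>U. ((\<lambda>t. f (x(i := t)) j) has_real_derivative f' j i x) (at (x i))))"
      by (rule choice[OF allI])
    then obtain f' where f': "\<And>i j. i < d \<Longrightarrow> j < m \<Longrightarrow> C_k k d U (f' j i)"
      "\<And>i j x. i < d \<Longrightarrow> j < m \<Longrightarrow> x \<in> U \<Longrightarrow>
        ((\<lambda>t. f (x(i := t)) j) has_real_derivative f' j i x) (at (x i))"
      by blast
    obtain g' where g': "\<And>j. j < m \<Longrightarrow> C_k k m V (g' j)"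
      "\<And>j y. j < m \<Longrightarrow> y \<in> V \<Longrightarrow> ((\<lambda>t. g (y(j := t))) has_real_derivative g' j y) (at (y j))"
      using Suc.prems(2) by (rule C_k_SucE) blast
    have "continuous_on U (\<lambda>x. g (f x))"
      using cont[OF Suc.prems] by simp
    moreover have "C_k k d U (\<lambda>x. \<Sum>j<m. g' j (f x) * f' j i x)" if "i < d" for i
    proof (rule C_k_sum)
      fix j assume "j \<in> {..<m}"
      then have j: "j < m" by simp
      show "C_k k d U (\<lambda>x. g' j (f x) * f' j i x)"
        by (rule C_k_mult[OF Suc.IH[OF C_k_SucD[OF Suc.prems(1)] g'(1)[OF j]] f'(1)[OF that j]])
    qed simp
    moreover have "((\<lambda>t. g (f (x(i := t)))) has_real_derivative
        (\<Sum>j<m. g' j (f x) * f' j i x)) (at (x i))" if "i < d" "x \<in> U" for i x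
    proof -
      have "\<forall>\<^sub>F t in nhds (x i). f (x(i := t)) \<in> V"
        using eventually_coordinate_line_in[OF U that(2,1)] by eventually_elim (rule funcset_mem[OF fV])
      moreover have "f (x(i := x i)) \<in> V"
        using fV that(2) by auto
      ultimately show ?thesis
        using chain_rule_along_curve[where c = "\<lambda>t. f (x(i := t))" and c' = "\<lambda>j. f' j i x"
            and ?t0.0 = "x i", OF V C_k_imp_continuous_on[OF g'(1)] g'(2) _ _ f'(2)[OF that(1) _ that(2)]]
        by simp
    qed
    ultimately show ?case
      by (rule C_k_SucI)
  qed
qed


section \<open>Smooth maps between open subsets of Euclidean spaces\<close>

lemma smooth_real_on_imp_openin: "smooth_real_on d U f \<Longrightarrow> openin (Euclidean_space d) U"
  by (simp add: smooth_real_on_def)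

lemma smooth_real_on_const: "openin (Euclidean_space d) U \<Longrightarrow> smooth_real_on d U (\<lambda>_. c)"
  by (simp add: smooth_real_on_def C_k_const)

lemma smooth_real_on_mult:
  "smooth_real_on d U f \<Longrightarrow> smooth_real_on d U g \<Longrightarrow> smooth_real_on d U (\<lambda>x. f x * g x)"
  by (simp add: smooth_real_on_def C_k_mult)

lemma smooth_real_on_sum:
  assumes "openin (Euclidean_space d) U" "finite I" "\<And>j. j \<in> I \<Longrightarrow> smooth_real_on d U (f j)"
  shows "smooth_real_on d U (\<lambda>x. \<Sum>j\<in>I. f j x)"
  using assms by (simp add: smooth_real_on_def C_k_sum)

lemma smooth_real_on_cong:
  assumes "smooth_real_on d U f" "\<And>x. x \<in> U \<Longrightarrow> f x = g x"
  shows "smooth_real_on d U g"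
  using assms C_k_cong[of d U f g] by (simp add: smooth_real_on_def)

lemma smooth_real_on_subset:
  assumes "smooth_real_on d U f" "openin (Euclidean_space d) W" "W \<subseteq> U"
  shows "smooth_real_on d W f"
  using assms C_k_mono[OF assms(3)] by (simp add: smooth_real_on_def)

lemma smooth_real_on_local:
  assumes "\<And>x. x \<in> U \<Longrightarrow> \<exists>W. x \<in> W \<and> W \<subseteq> U \<and> smooth_real_on d W f"
  shows "smooth_real_on d U f"
  unfolding smooth_real_on_def
proof (intro conjI allI)
  show U: "openin (Euclidean_space d) U"
    by (subst openin_subopen) (use assms in \<open>meson smooth_real_on_imp_openin\<close>)
  fix k
  show "C_k k d U f"
  proof (rule C_k_local[OF U])
    fix x assume "x \<in> U"
    then obtain W where "x \<in> W" "W \<subseteq> U" "smooth_real_on d W f"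
      using assms by meson
    then show "\<exists>W. openin (Euclidean_space d) W \<and> x \<in> W \<and> W \<subseteq> U \<and> C_k k d W f"
      by (intro exI[of _ W]) (simp add: smooth_real_on_def)
  qed
qed

lemma smooth_betweenD:
  assumes "smooth_between d m U f"
  shows "openin (Euclidean_space d) U" "f \<in> U \<rightarrow> topspace (Euclidean_space m)"
    "\<And>j. j < m \<Longrightarrow> smooth_real_on d U (\<lambda>x. f x j)"
  using assms by (simp_all add: smooth_between_def)

lemma smooth_between_coordinate:
  assumes "smooth_between d m U f"
  shows "smooth_real_on d U (\<lambda>x. f x j)"
proof (cases "j < m")
  case True
  then show ?thesis by (rule smooth_betweenD(3)[OF assms])
next
  case False
  have "smooth_real_on d U (\<lambda>_. 0)"
    by (rule smooth_real_on_const[OF smooth_betweenD(1)[OF assms]])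
  then show ?thesis
    by (rule smooth_real_on_cong)
      (use False funcset_mem[OF smooth_betweenD(2)[OF assms]] in
        \<open>simp add: topspace_Euclidean_space\<close>)
qed

lemma smooth_between_cong:
  assumes "smooth_between d m U f" "\<And>x. x \<in> U \<Longrightarrow> f x = g x"
  shows "smooth_between d m U g"
  unfolding smooth_between_def
proof (intro conjI allI impI)
  show "openin (Euclidean_space d) U" by (rule smooth_betweenD(1)[OF assms(1)])
  show "g \<in> U \<rightarrow> topspace (Euclidean_space m)"
    using smooth_betweenD(2)[OF assms(1)] assms(2) by (simp add: Pi_iff)
  show "smooth_real_on d U (\<lambda>x. g x j)" for j
    by (rule smooth_real_on_cong[OF smooth_between_coordinate[OF assms(1), of j]])
      (simp add: assms(2))
qed

lemma smooth_between_subset: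
  assumes "smooth_between d m U f" "openin (Euclidean_space d) W" "W \<subseteq> U"
  shows "smooth_between d m W f"
  using smooth_betweenD[OF assms(1)] assms(2,3)
  by (auto simp: smooth_between_def intro: smooth_real_on_subset)

lemma smooth_between_local:
  assumes "\<And>x. x \<in> U \<Longrightarrow> \<exists>W. x \<in> W \<and> W \<subseteq> U \<and> smooth_between d m W f"
  shows "smooth_between d m U f"
  unfolding smooth_between_def
proof (intro conjI allI impI)
  show "openin (Euclidean_space d) U"
    by (subst openin_subopen) (use assms in \<open>meson smooth_betweenD(1)\<close>)
  show "f \<in> U \<rightarrow> topspace (Euclidean_space m)"
  proof
    fix x assume "x \<in> U"
    then obtain W where "x \<in> W" "smooth_between d m W f"
      using assms by meson
    then show "f x \<in> topspace (Euclidean_space m)"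
      using smooth_betweenD(2) by blast
  qed
  show "smooth_real_on d U (\<lambda>x. f x j)" for j
  proof (rule smooth_real_on_local)
    fix x assume "x \<in> U"
    then obtain W where "x \<in> W" "W \<subseteq> U" "smooth_between d m W f"
      using assms by meson
    then show "\<exists>W. x \<in> W \<and> W \<subseteq> U \<and> smooth_real_on d W (\<lambda>x. f x j)"
      by (intro exI[of _ W] conjI smooth_between_coordinate)
  qed
qed

lemma smooth_between_const:
  assumes "openin (Euclidean_space d) U" "c \<in> topspace (Euclidean_space m)"
  shows "smooth_between d m U (\<lambda>_. c)"
  using assms by (simp add: smooth_between_def smooth_real_on_const)

lemma smooth_between_id:
  assumes "openin (Euclidean_space d) U"
  shows "smooth_between d d U (\<lambda>x. x)"
  using assms openin_subset[OF assms]
  by (auto simp: smooth_between_def smooth_real_on_def C_k_coordinate)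

lemma smooth_between_continuous_map:
  assumes "smooth_between d m U f"
  shows "continuous_map (subtopology (Euclidean_space d) U) (Euclidean_space m) f"
proof -
  note U = openin_subset[OF smooth_betweenD(1)[OF assms]]
  have "continuous_on U (\<lambda>x. f x j)" for j
    using smooth_between_coordinate[OF assms, of j]
    by (auto simp: smooth_real_on_def intro: C_k_imp_continuous_on)
  then have "continuous_on U f"
    by (rule continuous_on_coordinatewise_then_product)
  then have "continuous_map (top_of_set U) (powertop_real UNIV) f"
    by (simp add: euclidean_product_topology)
  moreover have "f \<in> U \<rightarrow> {x. \<forall>i\<ge>m. x i = 0}"
    using smooth_betweenD(2)[OF assms] by (simp add: topspace_Euclidean_space)
  ultimately show ?thesis
    unfolding subtopology_Euclidean_space[OF U]
    by (simp add: Euclidean_space_def[of m] continuous_map_in_subtopology image_subset_iff_funcset)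
qed

lemma smooth_between_openin_preimage:
  assumes "smooth_between d m U f" "openin (Euclidean_space m) V"
  shows "openin (Euclidean_space d) {x \<in> U. f x \<in> V}"
proof -
  note U = smooth_betweenD(1)[OF assms(1)]
  have "openin (subtopology (Euclidean_space d) U) {x \<in> topspace (subtopology (Euclidean_space d) U). f x \<in> V}"
    by (rule openin_continuous_map_preimage[OF smooth_between_continuous_map[OF assms(1)] assms(2)])
  then have "openin (subtopology (Euclidean_space d) U) {x \<in> U. f x \<in> V}"
    using openin_subset[OF U] by (simp add: Int_absorb1)
  then show ?thesis
    by (rule openin_trans_full[OF _ U])
qed

lemma smooth_real_on_compose:
  assumes f: "smooth_between d m U f" and g: "smooth_real_on m V g" and fV: "f \<in> U \<rightarrow> V"
  shows "smooth_real_on d U (\<lambda>x. g (f x))"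
  unfolding smooth_real_on_def
proof (intro conjI allI)
  show U: "openin (Euclidean_space d) U" by (rule smooth_betweenD(1)[OF f])
  show "C_k k d U (\<lambda>x. g (f x))" for k
  proof (rule C_k_compose[OF U _ fV])
    show "openin (Euclidean_space m) V" by (rule smooth_real_on_imp_openin[OF g])
    show "C_k k d U (\<lambda>x. f x j)" for j
      using smooth_between_coordinate[OF f, of j] by (simp add: smooth_real_on_def)
    show "C_k k m V g"
      using g by (simp add: smooth_real_on_def)
  qed
qed

lemma smooth_between_compose:
  assumes f: "smooth_between d m U f" and g: "smooth_between m n V g" and fV: "f \<in> U \<rightarrow> V"
  shows "smooth_between d n U (\<lambda>x. g (f x))"
  unfolding smooth_between_def
proof (intro conjI allI impI)
  show "openin (Euclidean_space d) U" by (rule smooth_betweenD(1)[OF f])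
  show "(\<lambda>x. g (f x)) \<in> U \<rightarrow> topspace (Euclidean_space n)"
    using smooth_betweenD(2)[OF g] fV by (simp add: Pi_iff)
  show "smooth_real_on d U (\<lambda>x. g (f x) j)" for j
    by (rule smooth_real_on_compose[OF f smooth_between_coordinate[OF g] fV])
qed

lemma smooth_between_join:
  assumes f: "smooth_between d m U f" and g: "smooth_between d n U g"
  shows "smooth_between d (m + n) U (\<lambda>x. join_coords m (f x) (g x))"
  unfolding smooth_between_def
proof (intro conjI allI impI)
  show "openin (Euclidean_space d) U" by (rule smooth_betweenD(1)[OF f])
  show "(\<lambda>x. join_coords m (f x) (g x)) \<in> U \<rightarrow> topspace (Euclidean_space (m + n))"
    using smooth_betweenD(2)[OF g] by (fastforce simp: topspace_Euclidean_space join_coords_def Pi_iff)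
  show "smooth_real_on d U (\<lambda>x. join_coords m (f x) (g x) j)" for j
    using smooth_between_coordinate[OF f] smooth_between_coordinate[OF g]
    by (cases "j < m") (simp_all add: join_coords_def)
qed

text \<open>The value \<open>join_coords m x y\<close> does not see the coordinates of \<open>x\<close> from \<open>m\<close> on, which is why
  the first component is asked to take values in \<open>\<real>\<^sup>m\<close>.\<close>

lemma smooth_between_join_fst:
  assumes "smooth_between d (m + n) U (\<lambda>x. join_coords m (f x) (g x))"
    and "f \<in> U \<rightarrow> topspace (Euclidean_space m)"
  shows "smooth_between d m U f"
  unfolding smooth_between_def
proof (intro conjI allI impI)
  fix j assume "j < m"
  then show "smooth_real_on d U (\<lambda>x. f x j)"
    using smooth_between_coordinate[OF assms(1), of j] by (simp add: join_coords_def)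
qed (use assms smooth_betweenD(1) in auto)

lemma smooth_between_join_snd:
  assumes "smooth_between d (m + n) U (\<lambda>x. join_coords m (f x) (g x))"
  shows "smooth_between d n U g"
  unfolding smooth_between_def
proof (intro conjI allI impI)
  show "openin (Euclidean_space d) U" by (rule smooth_betweenD(1)[OF assms])
  show "smooth_real_on d U (\<lambda>x. g x j)" for j
    using smooth_between_coordinate[OF assms, of "m + j"] by (simp add: join_coords_def)
  show "g \<in> U \<rightarrow> topspace (Euclidean_space n)"
  proof
    fix x assume "x \<in> U"
    have "g x i = 0" if "n \<le> i" for i
      using funcset_mem[OF smooth_betweenD(2)[OF assms] \<open>x \<in> U\<close>] that
      unfolding topspace_Euclidean_space join_coords_def
      by (auto dest!: spec[of _ "m + i"])
    then show "g x \<in> topspace (Euclidean_space n)"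
      by (simp add: topspace_Euclidean_space)
  qed
qed

section \<open>Plots of the standard diffeology\<close>

abbreviation plot :: "'a manifold \<Rightarrow> nat \<Rightarrow> (nat \<Rightarrow> real) set \<Rightarrow> ((nat \<Rightarrow> real) \<Rightarrow> 'a) \<Rightarrow> bool" where
  "plot M \<equiv> df_plot (standard_diffeology M)"

text \<open>
  The part of a smooth structure that is needed to localize a map to charts and to recover points
  from their coordinates. Leaving out the topology makes it stable under restriction to an arbitrary
  subset and under products.
\<close>

definition charted :: "'a manifold \<Rightarrow> bool" where
  "charted M \<longleftrightarrow>
     (\<Union>(U, \<phi>) \<in> mf_atlas M. U) = topspace (mf_top M) \<and>
     (\<forall>(U, \<phi>) \<in> mf_atlas M. inj_on \<phi> U \<and> \<phi> \<in> U \<rightarrow> topspace (Euclidean_space (mf_dim M)))"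

lemma chartedD:
  assumes "charted M"
  shows "\<And>x. x \<in> topspace (mf_top M) \<Longrightarrow> \<exists>U \<phi>. (U, \<phi>) \<in> mf_atlas M \<and> x \<in> U"
    and "\<And>U \<phi>. (U, \<phi>) \<in> mf_atlas M \<Longrightarrow> U \<subseteq> topspace (mf_top M)"
    and "\<And>U \<phi>. (U, \<phi>) \<in> mf_atlas M \<Longrightarrow> inj_on \<phi> U"
    and "\<And>U \<phi>. (U, \<phi>) \<in> mf_atlas M \<Longrightarrow> \<phi> \<in> U \<rightarrow> topspace (Euclidean_space (mf_dim M))"
proof -
  have U: "(\<Union>(U, \<phi>) \<in> mf_atlas M. U) = topspace (mf_top M)"
    and C: "\<forall>(U, \<phi>) \<in> mf_atlas M. inj_on \<phi> U \<and> \<phi> \<in> U \<rightarrow> topspace (Euclidean_space (mf_dim M))"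
    using assms unfolding charted_def by (fact conjunct1, fact conjunct2)
  show "\<exists>U \<phi>. (U, \<phi>) \<in> mf_atlas M \<and> x \<in> U" if "x \<in> topspace (mf_top M)" for x
    using that unfolding U[symmetric] by blast
  show "U \<subseteq> topspace (mf_top M)" if "(U, \<phi>) \<in> mf_atlas M" for U \<phi>
    using that unfolding U[symmetric] by blast
  show "inj_on \<phi> U" "\<phi> \<in> U \<rightarrow> topspace (Euclidean_space (mf_dim M))"
    if "(U, \<phi>) \<in> mf_atlas M" for U \<phi>
    using bspec[OF C that] by simp_all
qed

lemma chartedI:
  assumes "\<And>x. x \<in> topspace (mf_top M) \<Longrightarrow> \<exists>U \<phi>. (U, \<phi>) \<in> mf_atlas M \<and> x \<in> U"
    and "\<And>U \<phi>. (U, \<phi>) \<in> mf_atlas M \<Longrightarrow> U \<subseteq> topspace (mf_top M)"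
    and "\<And>U \<phi>. (U, \<phi>) \<in> mf_atlas M \<Longrightarrow> inj_on \<phi> U"
    and "\<And>U \<phi>. (U, \<phi>) \<in> mf_atlas M \<Longrightarrow> \<phi> \<in> U \<rightarrow> topspace (Euclidean_space (mf_dim M))"
  shows "charted M"
  unfolding charted_def
proof (intro conjI)
  show "(\<Union>(U, \<phi>) \<in> mf_atlas M. U) = topspace (mf_top M)"
    using assms(1,2) by fast
  show "\<forall>(U, \<phi>) \<in> mf_atlas M. inj_on \<phi> U \<and> \<phi> \<in> U \<rightarrow> topspace (Euclidean_space (mf_dim M))"
    using assms(3,4) by fast
qed

lemma smooth_manifold_chart:
  assumes "smooth_manifold M" "(U, \<phi>) \<in> mf_atlas M"
  shows "chart (mf_top M) (mf_dim M) U \<phi>"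
  using assms unfolding smooth_manifold_def by fast

lemma smooth_manifold_imp_charted:
  assumes M: "smooth_manifold M"
  shows "charted M"
proof (rule chartedI)
  have cover: "(\<Union>(U, \<phi>) \<in> mf_atlas M. U) = topspace (mf_top M)"
    using M unfolding smooth_manifold_def by (elim conjE)
  show "\<exists>U \<phi>. (U, \<phi>) \<in> mf_atlas M \<and> x \<in> U" if "x \<in> topspace (mf_top M)" for x
    using that unfolding cover[symmetric] by blast
  fix U \<phi> assume "(U, \<phi>) \<in> mf_atlas M"
  then have c: "chart (mf_top M) (mf_dim M) U \<phi>"
    by (rule smooth_manifold_chart[OF M])
  then show U: "U \<subseteq> topspace (mf_top M)"
    unfolding chart_def by (intro openin_subset) (elim conjE)
  have "homeomorphic_map (subtopology (mf_top M) U)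
      (subtopology (Euclidean_space (mf_dim M)) (\<phi> ` U)) \<phi>"
    using c unfolding chart_def by (elim conjE)
  then show "inj_on \<phi> U"
    using U by (simp add: homeomorphic_eq_everything_map Int_absorb1)
  have "\<phi> ` U \<subseteq> topspace (Euclidean_space (mf_dim M))"
    using c unfolding chart_def by (intro openin_subset) (elim conjE)
  then show "\<phi> \<in> U \<rightarrow> topspace (Euclidean_space (mf_dim M))"
    by blast
qed

lemma charted_open_submanifold:
  assumes "charted M"
  shows "charted (open_submanifold M S)"
proof (rule chartedI)
  fix x assume "x \<in> topspace (mf_top (open_submanifold M S))"
  then have "x \<in> topspace (mf_top M)" "x \<in> S"
    by (simp_all add: open_submanifold_def)
  then obtain U \<phi> where "(U, \<phi>) \<in> mf_atlas M" "x \<in> U"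
    using chartedD(1)[OF assms] by blast
  then have "(U \<inter> S, \<phi>) \<in> mf_atlas (open_submanifold M S)" "x \<in> U \<inter> S"
    using \<open>x \<in> S\<close> by (auto simp: open_submanifold_def)
  then show "\<exists>U \<phi>. (U, \<phi>) \<in> mf_atlas (open_submanifold M S) \<and> x \<in> U"
    by blast
next
  fix U \<phi> assume "(U, \<phi>) \<in> mf_atlas (open_submanifold M S)"
  then obtain V where V: "(V, \<phi>) \<in> mf_atlas M" "U = V \<inter> S"
    by (auto simp: open_submanifold_def)
  show "U \<subseteq> topspace (mf_top (open_submanifold M S))"
    using chartedD(2)[OF assms V(1)] V(2) by (auto simp: open_submanifold_def)
  show "inj_on \<phi> U"
    using chartedD(3)[OF assms V(1)] V(2) by (simp add: inj_on_Int)
  show "\<phi> \<in> U \<rightarrow> topspace (Euclidean_space (mf_dim (open_submanifold M S)))"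
    using chartedD(4)[OF assms V(1)] V(2) by (auto simp: open_submanifold_def)
qed

lemma charted_euclidean_manifold: "charted (euclidean_manifold n)"
  by (rule chartedI) (auto simp: euclidean_manifold_def)

lemma charted_product_manifold:
  assumes M: "charted M" and N: "charted N"
  shows "charted (product_manifold M N)"
proof (rule chartedI)
  fix z assume "z \<in> topspace (mf_top (product_manifold M N))"
  then obtain x y where z: "z = (x, y)" "x \<in> topspace (mf_top M)" "y \<in> topspace (mf_top N)"
    by (auto simp: product_manifold_def)
  obtain U \<phi> V \<psi> where "(U, \<phi>) \<in> mf_atlas M" "x \<in> U" "(V, \<psi>) \<in> mf_atlas N" "y \<in> V"
    using chartedD(1)[OF M z(2)] chartedD(1)[OF N z(3)] by blast
  then have "(U \<times> V, \<lambda>(x, y). join_coords (mf_dim M) (\<phi> x) (\<psi> y)) \<in> mf_atlas (product_manifold M N)"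
    "z \<in> U \<times> V"
    by (auto simp: product_manifold_def z(1))
  then show "\<exists>U \<phi>. (U, \<phi>) \<in> mf_atlas (product_manifold M N) \<and> z \<in> U"
    by blast
next
  fix S \<kappa> assume "(S, \<kappa>) \<in> mf_atlas (product_manifold M N)"
  then obtain U \<phi> V \<psi> where c: "(U, \<phi>) \<in> mf_atlas M" "(V, \<psi>) \<in> mf_atlas N" "S = U \<times> V"
    "\<kappa> = (\<lambda>(x, y). join_coords (mf_dim M) (\<phi> x) (\<psi> y))"
    by (auto simp: product_manifold_def)
  note \<phi> = chartedD(2-4)[OF M c(1)] and \<psi> = chartedD(2-4)[OF N c(2)]
  show "S \<subseteq> topspace (mf_top (product_manifold M N))"
    using \<phi>(1) \<psi>(1) c(3) by (auto simp: product_manifold_def)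
  show "inj_on \<kappa> S"
  proof (rule inj_onI)
    fix z z' assume zz: "z \<in> S" "z' \<in> S" "\<kappa> z = \<kappa> z'"
    obtain x y x' y' where z: "z = (x, y)" "z' = (x', y')"
      by fastforce
    have mem: "x \<in> U" "x' \<in> U" "y \<in> V" "y' \<in> V"
      using zz z c(3) by auto
    have eq: "join_coords (mf_dim M) (\<phi> x) (\<psi> y) i = join_coords (mf_dim M) (\<phi> x') (\<psi> y') i" for i
      using zz(3) z c(4) by simp
    have "\<phi> x i = \<phi> x' i" for i
    proof (cases "i < mf_dim M")
      case True
      then show ?thesis using eq[of i] by (simp add: join_coords_def)
    next
      case False
      then show ?thesis
        using funcset_mem[OF \<phi>(3)] mem(1,2) by (simp add: topspace_Euclidean_space)
    qed
    moreover have "\<psi> y i = \<psi> y' i" for i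
      using eq[of "mf_dim M + i"] by (simp add: join_coords_def)
    ultimately show "z = z'"
      using z mem inj_onD[OF \<phi>(2)] inj_onD[OF \<psi>(2)] by (simp add: fun_eq_iff)
  qed
  show "\<kappa> \<in> S \<rightarrow> topspace (Euclidean_space (mf_dim (product_manifold M N)))"
    unfolding c(3,4) using \<psi>(3)
    by (fastforce simp: product_manifold_def topspace_Euclidean_space join_coords_def Pi_iff)
qed

text \<open>
  The domain of a plot has the identity as its only chart, so the inverse chart disappears.
  Continuity is spelled out by preimages: then restricting, composing and gluing plots are
  statements about open subsets of \<open>\<real>\<^sup>d\<close>.
\<close>

lemma plot_iff:
  "plot M d W p \<longleftrightarrow>
     openin (Euclidean_space d) W \<and> p \<in> W \<rightarrow> topspace (mf_top M) \<and>
     (\<forall>V. openin (mf_top M) V \<longrightarrow> openin (Euclidean_space d) {w \<in> W. p w \<in> V}) \<and>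
     (\<forall>(V, \<psi>) \<in> mf_atlas M. smooth_between d (mf_dim M) {w \<in> W. p w \<in> V} (\<lambda>w. \<psi> (p w)))"
proof (cases "openin (Euclidean_space d) W")
  case True
  note W = openin_subset[OF True]
  have top: "topspace (subtopology (Euclidean_space d) W) = W"
    using W by (simp add: Int_absorb1)
  have "openin (subtopology (Euclidean_space d) W) {w \<in> W. p w \<in> V} \<longleftrightarrow>
      openin (Euclidean_space d) {w \<in> W. p w \<in> V}" for V
    using openin_open_subtopology[OF True] by simp
  then have cont: "continuous_map (subtopology (Euclidean_space d) W) (mf_top M) p \<longleftrightarrow>
      p \<in> W \<rightarrow> topspace (mf_top M) \<and>
      (\<forall>V. openin (mf_top M) V \<longrightarrow> openin (Euclidean_space d) {w \<in> W. p w \<in> V})"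
    unfolding continuous_map_def top by (simp add: Pi_iff)
  have inv: "inv_into W id w = w" if "w \<in> W" for w
    using inv_into_f_f[of id W w] that by simp
  have "smooth_between d (mf_dim M) {w \<in> W. p w \<in> V} (\<psi> \<circ> p \<circ> inv_into W id) \<longleftrightarrow>
      smooth_between d (mf_dim M) {w \<in> W. p w \<in> V} (\<lambda>w. \<psi> (p w))" for V \<psi>
    by (rule iffI; erule smooth_between_cong) (simp_all add: inv)
  moreover have "{x \<in> topspace (Euclidean_space d). x \<in> W \<and> p x \<in> V} = {w \<in> W. p w \<in> V}" for V
    using W by auto
  ultimately show ?thesis
    unfolding standard_diffeology_def smooth_manifold_map_def
    using W True cont
    by (simp add: open_submanifold_def euclidean_manifold_def Int_absorb1 Int_absorb2)
qed (simp add: standard_diffeology_def)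

lemma plotI:
  assumes "openin (Euclidean_space d) W" "p \<in> W \<rightarrow> topspace (mf_top M)"
    and "\<And>V. openin (mf_top M) V \<Longrightarrow> openin (Euclidean_space d) {w \<in> W. p w \<in> V}"
    and "\<And>V \<psi>. (V, \<psi>) \<in> mf_atlas M \<Longrightarrow>
      smooth_between d (mf_dim M) {w \<in> W. p w \<in> V} (\<lambda>w. \<psi> (p w))"
  shows "plot M d W p"
  unfolding plot_iff using assms by blast

lemma plotD:
  assumes "plot M d W p"
  shows "openin (Euclidean_space d) W" "p \<in> W \<rightarrow> topspace (mf_top M)"
    and "\<And>V. openin (mf_top M) V \<Longrightarrow> openin (Euclidean_space d) {w \<in> W. p w \<in> V}"
    and "\<And>V \<psi>. (V, \<psi>) \<in> mf_atlas M \<Longrightarrow>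
      smooth_between d (mf_dim M) {w \<in> W. p w \<in> V} (\<lambda>w. \<psi> (p w))"
  using assms unfolding plot_iff by blast+

lemma plot_cong:
  assumes p: "plot M d W p" and eq: "\<And>w. w \<in> W \<Longrightarrow> p w = p' w"
  shows "plot M d W p'"
proof (rule plotI)
  show "openin (Euclidean_space d) W" by (rule plotD(1)[OF p])
  show "p' \<in> W \<rightarrow> topspace (mf_top M)"
    using plotD(2)[OF p] eq by (simp add: Pi_iff)
  have sets: "{w \<in> W. p' w \<in> V} = {w \<in> W. p w \<in> V}" for V
    using eq by auto
  show "openin (Euclidean_space d) {w \<in> W. p' w \<in> V}" if "openin (mf_top M) V" for V
    unfolding sets by (rule plotD(3)[OF p that])
  show "smooth_between d (mf_dim M) {w \<in> W. p' w \<in> V} (\<lambda>w. \<psi> (p' w))"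
    if "(V, \<psi>) \<in> mf_atlas M" for V \<psi>
    unfolding sets by (rule smooth_between_cong[OF plotD(4)[OF p that]]) (simp add: eq)
qed

lemma plot_compose:
  assumes p: "plot M d W p" and f: "smooth_between d' d W' f" and fW: "f \<in> W' \<rightarrow> W"
  shows "plot M d' W' (\<lambda>w. p (f w))"
proof (rule plotI)
  show W': "openin (Euclidean_space d') W'" by (rule smooth_betweenD(1)[OF f])
  show "(\<lambda>w. p (f w)) \<in> W' \<rightarrow> topspace (mf_top M)"
    using plotD(2)[OF p] fW by (simp add: Pi_iff)
  have sets: "{w \<in> W'. p (f w) \<in> V} = {w \<in> W'. f w \<in> {w \<in> W. p w \<in> V}}" for V
    using fW by auto
  show "openin (Euclidean_space d') {w \<in> W'. p (f w) \<in> V}" if "openin (mf_top M) V" for V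
    unfolding sets by (rule smooth_between_openin_preimage[OF f plotD(3)[OF p that]])
  fix V \<psi> assume V: "(V, \<psi>) \<in> mf_atlas M"
  note s = plotD(4)[OF p V]
  have "smooth_between d' d {w \<in> W'. p (f w) \<in> V} f"
    unfolding sets
    by (rule smooth_between_subset[OF f smooth_between_openin_preimage[OF f smooth_betweenD(1)[OF s]]])
      blast
  then show "smooth_between d' (mf_dim M) {w \<in> W'. p (f w) \<in> V} (\<lambda>w. \<psi> (p (f w)))"
    by (rule smooth_between_compose[OF _ s]) (use fW in auto)
qed

lemma plot_subset:
  assumes "plot M d W p" "openin (Euclidean_space d) W'" "W' \<subseteq> W"
  shows "plot M d W' p"
  using plot_compose[OF assms(1) smooth_between_id[OF assms(2)]] assms(3) by auto

lemma plot_local: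
  assumes loc: "\<And>w. w \<in> W \<Longrightarrow> \<exists>W'. w \<in> W' \<and> W' \<subseteq> W \<and> plot M d W' p"
  shows "plot M d W p"
proof (rule plotI)
  show "openin (Euclidean_space d) W"
    by (subst openin_subopen) (use loc in \<open>meson plotD(1)\<close>)
  show "p \<in> W \<rightarrow> topspace (mf_top M)"
  proof
    fix w assume "w \<in> W"
    then obtain W' where "w \<in> W'" "plot M d W' p"
      using loc by meson
    then show "p w \<in> topspace (mf_top M)"
      using plotD(2) by blast
  qed
  show "openin (Euclidean_space d) {w \<in> W. p w \<in> V}" if V: "openin (mf_top M) V" for V
  proof (subst openin_subopen, rule ballI)
    fix w assume w: "w \<in> {w \<in> W. p w \<in> V}"
    then obtain W' where W': "w \<in> W'" "W' \<subseteq> W" "plot M d W' p"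
      using loc by blast
    show "\<exists>T. openin (Euclidean_space d) T \<and> w \<in> T \<and> T \<subseteq> {w \<in> W. p w \<in> V}"
      by (rule exI[of _ "{w \<in> W'. p w \<in> V}"]) (use plotD(3)[OF W'(3) V] W'(1,2) w in auto)
  qed
  fix V \<psi> assume V: "(V, \<psi>) \<in> mf_atlas M"
  show "smooth_between d (mf_dim M) {w \<in> W. p w \<in> V} (\<lambda>w. \<psi> (p w))"
  proof (rule smooth_between_local)
    fix w assume w: "w \<in> {w \<in> W. p w \<in> V}"
    then obtain W' where W': "w \<in> W'" "W' \<subseteq> W" "plot M d W' p"
      using loc by blast
    show "\<exists>T. w \<in> T \<and> T \<subseteq> {w \<in> W. p w \<in> V} \<and> smooth_between d (mf_dim M) T (\<lambda>w. \<psi> (p w))"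
      by (rule exI[of _ "{w \<in> W'. p w \<in> V}"]) (use plotD(4)[OF W'(3) V] W'(1,2) w in auto)
  qed
qed

lemma plot_const:
  assumes M: "\<And>V \<psi>. (V, \<psi>) \<in> mf_atlas M \<Longrightarrow> \<psi> \<in> V \<rightarrow> topspace (Euclidean_space (mf_dim M))"
    and W: "openin (Euclidean_space d) W" and x: "x \<in> topspace (mf_top M)"
  shows "plot M d W (\<lambda>_. x)"
proof (rule plotI)
  have op: "openin (Euclidean_space d) {w \<in> W. x \<in> V}" for V
    using W by (cases "x \<in> V") simp_all
  then show "openin (Euclidean_space d) {w \<in> W. x \<in> V}" for V .
  show "smooth_between d (mf_dim M) {w \<in> W. x \<in> V} (\<lambda>_. \<psi> x)" if V: "(V, \<psi>) \<in> mf_atlas M" for V \<psi>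
  proof (cases "x \<in> V")
    case True
    then show ?thesis
      using smooth_between_const[OF W funcset_mem[OF M[OF V] True]] by simp
  next
    case False
    have "smooth_between d (mf_dim M) {} (\<lambda>_. \<psi> x)"
      by (rule smooth_between_local) simp
    with False show ?thesis
      by simp
  qed
qed (use W x in auto)

lemma diffeological_space_standard_diffeology:
  assumes M: "\<And>V \<psi>. (V, \<psi>) \<in> mf_atlas M \<Longrightarrow> \<psi> \<in> V \<rightarrow> topspace (Euclidean_space (mf_dim M))"
  shows "diffeological_space (standard_diffeology M)"
  unfolding diffeological_space_def
proof (intro conjI allI ballI impI)
  have pts: "df_points (standard_diffeology M) = topspace (mf_top M)"
    by (simp add: standard_diffeology_def)
  show "openin (Euclidean_space d) U" "p \<in> U \<rightarrow> df_points (standard_diffeology M)"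
    if "plot M d U p" for d U p
    using plotD(1,2)[OF that] by (simp_all add: pts)
  show "plot M d U p'" if "plot M d U p" "\<forall>u\<in>U. p u = p' u" for d U p p'
    using plot_cong[OF that(1)] that(2) by blast
  show "plot M d U (\<lambda>_. x)"
    if "x \<in> df_points (standard_diffeology M)" "openin (Euclidean_space d) U" for d U x
    using plot_const[OF M that(2)] that(1) pts by blast
  show "plot M d' U' (p \<circ> f)" if "plot M d U p" "smooth_between d' d U' f" "f \<in> U' \<rightarrow> U"
    for d U p d' U' f
    using plot_compose[OF that] by (simp add: comp_def)
  show "plot M d U p" if "\<forall>u\<in>U. \<exists>W. u \<in> W \<and> W \<subseteq> U \<and> plot M d W p" for d U p
    by (rule plot_local) (rule bspec[OF that])
qed

text \<open>
  In charts \<open>\<phi>\<close> of \<open>M\<close> and \<open>\<psi>\<close> of \<open>N\<close>, locally \<open>\<psi> \<circ> f \<circ> p = (\<psi> \<circ> f \<circ> \<phi>\<^sup>-\<^sup>1) \<circ> (\<phi> \<circ> p)\<close>, a composite of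
  smooth maps between Euclidean open sets.
\<close>

lemma smooth_manifold_map_plot:
  assumes M: "charted M" and f: "smooth_manifold_map M N f" and p: "plot M d W p"
  shows "plot N d W (\<lambda>w. f (p w))"
proof (rule plotI)
  have cont: "continuous_map (mf_top M) (mf_top N) f"
    and sm: "\<And>U \<phi> V \<psi>. (U, \<phi>) \<in> mf_atlas M \<Longrightarrow> (V, \<psi>) \<in> mf_atlas N \<Longrightarrow>
      smooth_between (mf_dim M) (mf_dim N) (\<phi> ` {x \<in> U. f x \<in> V}) (\<psi> \<circ> f \<circ> inv_into U \<phi>)"
    using f unfolding smooth_manifold_map_def by blast+
  note pM = funcset_mem[OF plotD(2)[OF p]]
  show "openin (Euclidean_space d) W" by (rule plotD(1)[OF p])
  show "(\<lambda>w. f (p w)) \<in> W \<rightarrow> topspace (mf_top N)"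
    using pM continuous_map_funspace[OF cont] by auto
  show "openin (Euclidean_space d) {w \<in> W. f (p w) \<in> V}" if "openin (mf_top N) V" for V
  proof -
    have "{w \<in> W. f (p w) \<in> V} = {w \<in> W. p w \<in> {x \<in> topspace (mf_top M). f x \<in> V}}"
      using pM by auto
    with plotD(3)[OF p openin_continuous_map_preimage[OF cont that]] show ?thesis
      by simp
  qed
  fix V \<psi> assume V: "(V, \<psi>) \<in> mf_atlas N"
  show "smooth_between d (mf_dim N) {w \<in> W. f (p w) \<in> V} (\<lambda>w. \<psi> (f (p w)))"
  proof (rule smooth_between_local)
    fix w assume "w \<in> {w \<in> W. f (p w) \<in> V}"
    then have w: "w \<in> W" "f (p w) \<in> V" by auto
    obtain U \<phi> where U: "(U, \<phi>) \<in> mf_atlas M" "p w \<in> U"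
      using chartedD(1)[OF M pM[OF w(1)]] by blast
    define Q where "Q = \<phi> ` {x \<in> U. f x \<in> V}"
    define T where "T = {w \<in> {w \<in> W. p w \<in> U}. \<phi> (p w) \<in> Q}"
    have inQ: "f (p w) \<in> V" if "w \<in> T" for w
      using that inj_onD[OF chartedD(3)[OF M U(1)]] by (auto simp: T_def Q_def)
    have "smooth_between d (mf_dim M) T (\<lambda>w. \<phi> (p w))"
      unfolding T_def
      by (rule smooth_between_subset[OF plotD(4)[OF p U(1)] smooth_between_openin_preimage[OF plotD(4)[OF p U(1)]]])
        (use smooth_betweenD(1)[OF sm[OF U(1) V]] in \<open>auto simp: Q_def\<close>)
    then have "smooth_between d (mf_dim N) T (\<lambda>w. (\<psi> \<circ> f \<circ> inv_into U \<phi>) (\<phi> (p w)))"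
      by (rule smooth_between_compose[OF _ sm[OF U(1) V]]) (auto simp: T_def Q_def)
    then have "smooth_between d (mf_dim N) T (\<lambda>w. \<psi> (f (p w)))"
      by (rule smooth_between_cong)
        (simp add: T_def inv_into_f_f[OF chartedD(3)[OF M U(1)]])
    moreover have "w \<in> T"
      using w U(2) by (auto simp: T_def Q_def)
    moreover have "T \<subseteq> {w \<in> W. f (p w) \<in> V}"
      using inQ by (auto simp: T_def)
    ultimately show "\<exists>T. w \<in> T \<and> T \<subseteq> {w \<in> W. f (p w) \<in> V} \<and>
        smooth_between d (mf_dim N) T (\<lambda>w. \<psi> (f (p w)))"
      by blast
  qed
qed

text \<open>Charts of a manifold are homeomorphisms between open sets, so smoothness in the charts
  already gives continuity.\<close>

lemma plot_if_smooth_in_charts: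
  assumes M: "smooth_manifold M" and W: "openin (Euclidean_space d) W"
    and p: "p \<in> W \<rightarrow> topspace (mf_top M)"
    and s: "\<And>U \<phi>. (U, \<phi>) \<in> mf_atlas M \<Longrightarrow>
      smooth_between d (mf_dim M) {w \<in> W. p w \<in> U} (\<lambda>w. \<phi> (p w))"
  shows "plot M d W p"
proof (rule plotI[OF W p _ s])
  fix V assume V: "openin (mf_top M) V"
  show "openin (Euclidean_space d) {w \<in> W. p w \<in> V}"
  proof (subst openin_subopen, rule ballI)
    fix w assume "w \<in> {w \<in> W. p w \<in> V}"
    then have w: "w \<in> W" "p w \<in> V" by auto
    obtain U \<phi> where U: "(U, \<phi>) \<in> mf_atlas M" "p w \<in> U"
      using chartedD(1)[OF smooth_manifold_imp_charted[OF M]] w p by blast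
    have c: "openin (mf_top M) U" "openin (Euclidean_space (mf_dim M)) (\<phi> ` U)"
      "homeomorphic_map (subtopology (mf_top M) U)
        (subtopology (Euclidean_space (mf_dim M)) (\<phi> ` U)) \<phi>"
      using smooth_manifold_chart[OF M U(1)] by (simp_all add: chart_def)
    have "openin (subtopology (mf_top M) U) (U \<inter> V)"
      using V c(1) by (simp add: openin_open_subtopology openin_Int)
    then have "openin (subtopology (Euclidean_space (mf_dim M)) (\<phi> ` U)) (\<phi> ` (U \<inter> V))"
      using homeomorphic_map_openness_eq[OF c(3)] by blast
    then have Q: "openin (Euclidean_space (mf_dim M)) (\<phi> ` (U \<inter> V))"
      by (rule openin_trans_full[OF _ c(2)])
    define T where "T = {w \<in> {w \<in> W. p w \<in> U}. \<phi> (p w) \<in> \<phi> ` (U \<inter> V)}"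
    have "openin (Euclidean_space d) T"
      unfolding T_def by (rule smooth_between_openin_preimage[OF s[OF U(1)] Q])
    moreover have "w \<in> T"
      using w U(2) by (auto simp: T_def)
    moreover have "T \<subseteq> {w \<in> W. p w \<in> V}"
      using inj_onD[OF chartedD(3)[OF smooth_manifold_imp_charted[OF M] U(1)]]
      by (auto simp: T_def)
    ultimately show "\<exists>T. openin (Euclidean_space d) T \<and> w \<in> T \<and> T \<subseteq> {w \<in> W. p w \<in> V}"
      by blast
  qed
qed

lemma plot_open_submanifold_iff:
  "plot (open_submanifold M S) d W p \<longleftrightarrow> plot M d W p \<and> p \<in> W \<rightarrow> S"
proof
  assume p: "plot (open_submanifold M S) d W p"
  have pS: "p \<in> W \<rightarrow> topspace (mf_top M)" "p \<in> W \<rightarrow> S"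
    using plotD(2)[OF p] by (auto simp: open_submanifold_def)
  have sets: "{w \<in> W. p w \<in> V \<inter> S} = {w \<in> W. p w \<in> V}" for V
    using pS by auto
  have "plot M d W p"
  proof (rule plotI[OF plotD(1)[OF p] pS(1)])
    show "openin (Euclidean_space d) {w \<in> W. p w \<in> V}" if "openin (mf_top M) V" for V
      using plotD(3)[OF p, of "V \<inter> S"] that unfolding sets
      by (auto simp: open_submanifold_def openin_subtopology)
    show "smooth_between d (mf_dim M) {w \<in> W. p w \<in> V} (\<lambda>w. \<psi> (p w))"
      if "(V, \<psi>) \<in> mf_atlas M" for V \<psi>
      using plotD(4)[OF p, of "V \<inter> S" \<psi>] that unfolding sets
      by (auto simp: open_submanifold_def)
  qed
  then show "plot M d W p \<and> p \<in> W \<rightarrow> S"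
    using pS(2) ..
next
  assume "plot M d W p \<and> p \<in> W \<rightarrow> S"
  then have p: "plot M d W p" and pS: "p \<in> W \<rightarrow> S" by auto
  have sets: "{w \<in> W. p w \<in> V \<inter> S} = {w \<in> W. p w \<in> V}" for V
    using pS by auto
  show "plot (open_submanifold M S) d W p"
  proof (rule plotI[OF plotD(1)[OF p]])
    show "p \<in> W \<rightarrow> topspace (mf_top (open_submanifold M S))"
      using plotD(2)[OF p] pS by (auto simp: open_submanifold_def)
    fix V assume "openin (mf_top (open_submanifold M S)) V"
    then obtain V' where "openin (mf_top M) V'" "V = V' \<inter> S"
      by (auto simp: open_submanifold_def openin_subtopology)
    then show "openin (Euclidean_space d) {w \<in> W. p w \<in> V}"
      using plotD(3)[OF p] sets by simp
  next
    fix V \<psi> assume "(V, \<psi>) \<in> mf_atlas (open_submanifold M S)"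
    then obtain V' where "(V', \<psi>) \<in> mf_atlas M" "V = V' \<inter> S"
      by (auto simp: open_submanifold_def)
    then show "smooth_between d (mf_dim (open_submanifold M S)) {w \<in> W. p w \<in> V} (\<lambda>w. \<psi> (p w))"
      using plotD(4)[OF p] sets by (simp add: open_submanifold_def)
  qed
qed

lemma plot_product_manifold:
  assumes p: "plot M d W p" and q: "plot N d W q"
  shows "plot (product_manifold M N) d W (\<lambda>w. (p w, q w))"
proof (rule plotI[OF plotD(1)[OF p]])
  show "(\<lambda>w. (p w, q w)) \<in> W \<rightarrow> topspace (mf_top (product_manifold M N))"
    using plotD(2)[OF p] plotD(2)[OF q] by (auto simp: product_manifold_def)
  fix V assume V: "openin (mf_top (product_manifold M N)) V"
  show "openin (Euclidean_space d) {w \<in> W. (p w, q w) \<in> V}"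
  proof (subst openin_subopen, rule ballI)
    fix w assume "w \<in> {w \<in> W. (p w, q w) \<in> V}"
    then have w: "w \<in> W" "(p w, q w) \<in> V" by auto
    have "\<exists>V1 V2. openin (mf_top M) V1 \<and> openin (mf_top N) V2 \<and> p w \<in> V1 \<and> q w \<in> V2 \<and> V1 \<times> V2 \<subseteq> V"
      using V w(2) by (simp add: product_manifold_def openin_prod_topology_alt)
    then obtain V1 V2 where V12: "openin (mf_top M) V1" "openin (mf_top N) V2" "p w \<in> V1" "q w \<in> V2"
      "V1 \<times> V2 \<subseteq> V"
      by blast
    have "openin (Euclidean_space d) ({w \<in> W. p w \<in> V1} \<inter> {w \<in> W. q w \<in> V2})"
      by (intro openin_Int plotD(3)[OF p] plotD(3)[OF q] V12)
    then show "\<exists>T. openin (Euclidean_space d) T \<and> w \<in> T \<and> T \<subseteq> {w \<in> W. (p w, q w) \<in> V}"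
      by (intro exI[of _ "{w \<in> W. p w \<in> V1} \<inter> {w \<in> W. q w \<in> V2}"]) (use w V12 in auto)
  qed
next
  fix S \<kappa> assume "(S, \<kappa>) \<in> mf_atlas (product_manifold M N)"
  then obtain U \<phi> V \<psi> where c: "(U, \<phi>) \<in> mf_atlas M" "(V, \<psi>) \<in> mf_atlas N" "S = U \<times> V"
    "\<kappa> = (\<lambda>(x, y). join_coords (mf_dim M) (\<phi> x) (\<psi> y))"
    by (auto simp: product_manifold_def)
  note sp = plotD(4)[OF p c(1)] and sq = plotD(4)[OF q c(2)]
  define T where "T = {w \<in> W. p w \<in> U} \<inter> {w \<in> W. q w \<in> V}"
  have T: "openin (Euclidean_space d) T"
    unfolding T_def by (intro openin_Int smooth_betweenD(1)[OF sp] smooth_betweenD(1)[OF sq])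
  have "smooth_between d (mf_dim M + mf_dim N) T (\<lambda>w. join_coords (mf_dim M) (\<phi> (p w)) (\<psi> (q w)))"
    by (intro smooth_between_join smooth_between_subset[OF sp T] smooth_between_subset[OF sq T])
      (auto simp: T_def)
  moreover have "{w \<in> W. (p w, q w) \<in> S} = T"
    by (auto simp: T_def c(3))
  ultimately show "smooth_between d (mf_dim (product_manifold M N)) {w \<in> W. (p w, q w) \<in> S}
      (\<lambda>w. \<kappa> (p w, q w))"
    by (simp add: c(4) product_manifold_def)
qed

text \<open>
  A product chart sees the first component only together with a chart around the second one. The
  charts of \<open>N\<close> cover, so the domains of the product charts over \<open>U\<close> cover the preimage of \<open>U\<close>.
\<close>

lemma plot_product_manifold_fst:
  assumes M: "charted M" and N: "charted N" and r: "plot (product_manifold M N) d W r"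
  shows "plot M d W (\<lambda>w. fst (r w))"
proof (rule plotI[OF plotD(1)[OF r]])
  have rW: "fst (r w) \<in> topspace (mf_top M)" "snd (r w) \<in> topspace (mf_top N)" if "w \<in> W" for w
    using funcset_mem[OF plotD(2)[OF r] that] by (auto simp: product_manifold_def)
  then show "(\<lambda>w. fst (r w)) \<in> W \<rightarrow> topspace (mf_top M)" by simp
  show "openin (Euclidean_space d) {w \<in> W. fst (r w) \<in> V}" if "openin (mf_top M) V" for V
  proof -
    have "openin (mf_top (product_manifold M N)) (V \<times> topspace (mf_top N))"
      using that by (simp add: product_manifold_def openin_prod_Times_iff)
    from plotD(3)[OF r this] show ?thesis
      using rW(2) by (simp add: mem_Times_iff cong: conj_cong)
  qed
  fix U \<phi> assume U: "(U, \<phi>) \<in> mf_atlas M"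
  show "smooth_between d (mf_dim M) {w \<in> W. fst (r w) \<in> U} (\<lambda>w. \<phi> (fst (r w)))"
  proof (rule smooth_between_local)
    fix w assume w: "w \<in> {w \<in> W. fst (r w) \<in> U}"
    obtain V \<psi> where V: "(V, \<psi>) \<in> mf_atlas N" "snd (r w) \<in> V"
      using chartedD(1)[OF N rW(2)] w by blast
    have "(U \<times> V, \<lambda>(x, y). join_coords (mf_dim M) (\<phi> x) (\<psi> y)) \<in> mf_atlas (product_manifold M N)"
      using U V by (auto simp: product_manifold_def)
    from plotD(4)[OF r this]
    have "smooth_between d (mf_dim M + mf_dim N) {w \<in> W. r w \<in> U \<times> V}
        (\<lambda>w. join_coords (mf_dim M) (\<phi> (fst (r w))) (\<psi> (snd (r w))))"
      by (simp add: product_manifold_def case_prod_beta)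
    then have "smooth_between d (mf_dim M) {w \<in> W. r w \<in> U \<times> V} (\<lambda>w. \<phi> (fst (r w)))"
      by (rule smooth_between_join_fst) (use chartedD(4)[OF M U] in auto)
    then show "\<exists>T. w \<in> T \<and> T \<subseteq> {w \<in> W. fst (r w) \<in> U} \<and>
        smooth_between d (mf_dim M) T (\<lambda>w. \<phi> (fst (r w)))"
      by (intro exI[of _ "{w \<in> W. r w \<in> U \<times> V}"]) (use w V(2) in \<open>auto simp: mem_Times_iff\<close>)
  qed
qed

lemma plot_product_manifold_snd:
  assumes M: "charted M" and r: "plot (product_manifold M N) d W r"
  shows "plot N d W (\<lambda>w. snd (r w))"
proof (rule plotI[OF plotD(1)[OF r]])
  have rW: "fst (r w) \<in> topspace (mf_top M)" "snd (r w) \<in> topspace (mf_top N)" if "w \<in> W" for w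
    using funcset_mem[OF plotD(2)[OF r] that] by (auto simp: product_manifold_def)
  then show "(\<lambda>w. snd (r w)) \<in> W \<rightarrow> topspace (mf_top N)" by simp
  show "openin (Euclidean_space d) {w \<in> W. snd (r w) \<in> V}" if "openin (mf_top N) V" for V
  proof -
    have "openin (mf_top (product_manifold M N)) (topspace (mf_top M) \<times> V)"
      using that by (simp add: product_manifold_def openin_prod_Times_iff)
    from plotD(3)[OF r this] show ?thesis
      using rW(1) by (simp add: mem_Times_iff cong: conj_cong)
  qed
  fix V \<psi> assume V: "(V, \<psi>) \<in> mf_atlas N"
  show "smooth_between d (mf_dim N) {w \<in> W. snd (r w) \<in> V} (\<lambda>w. \<psi> (snd (r w)))"
  proof (rule smooth_between_local)
    fix w assume w: "w \<in> {w \<in> W. snd (r w) \<in> V}"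
    obtain U \<phi> where U: "(U, \<phi>) \<in> mf_atlas M" "fst (r w) \<in> U"
      using chartedD(1)[OF M rW(1)] w by blast
    have "(U \<times> V, \<lambda>(x, y). join_coords (mf_dim M) (\<phi> x) (\<psi> y)) \<in> mf_atlas (product_manifold M N)"
      using U V by (auto simp: product_manifold_def)
    from plotD(4)[OF r this]
    have "smooth_between d (mf_dim M + mf_dim N) {w \<in> W. r w \<in> U \<times> V}
        (\<lambda>w. join_coords (mf_dim M) (\<phi> (fst (r w))) (\<psi> (snd (r w))))"
      by (simp add: product_manifold_def case_prod_beta)
    then have "smooth_between d (mf_dim N) {w \<in> W. r w \<in> U \<times> V} (\<lambda>w. \<psi> (snd (r w)))"
      by (rule smooth_between_join_snd)
    then show "\<exists>T. w \<in> T \<and> T \<subseteq> {w \<in> W. snd (r w) \<in> V} \<and>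
        smooth_between d (mf_dim N) T (\<lambda>w. \<psi> (snd (r w)))"
      by (intro exI[of _ "{w \<in> W. r w \<in> U \<times> V}"]) (use w U(2) in \<open>auto simp: mem_Times_iff\<close>)
  qed
qed

lemma plot_euclidean_manifold_iff: "plot (euclidean_manifold n) d W p \<longleftrightarrow> smooth_between d n W p"
proof
  assume p: "plot (euclidean_manifold n) d W p"
  have "{w \<in> W. p w \<in> topspace (Euclidean_space n)} = W"
    using plotD(2)[OF p] by (auto simp: euclidean_manifold_def)
  then show "smooth_between d n W p"
    using plotD(4)[OF p, of "topspace (Euclidean_space n)" id] by (simp add: euclidean_manifold_def)
next
  assume p: "smooth_between d n W p"
  have "{w \<in> W. p w \<in> topspace (Euclidean_space n)} = W"
    using smooth_betweenD(2)[OF p] by auto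
  then show "plot (euclidean_manifold n) d W p"
    using p smooth_between_openin_preimage[OF p] smooth_betweenD(1,2)[OF p]
    by (intro plotI) (auto simp: euclidean_manifold_def)
qed

lemma plot_real_manifold_iff: "plot real_manifold d W h \<longleftrightarrow> smooth_real_on d W h"
proof
  assume h: "plot real_manifold d W h"
  have "smooth_between d 1 W (\<lambda>w i. if i = 0 then h w else 0)"
    using plotD(4)[OF h] by (simp add: real_manifold_def)
  from smooth_between_coordinate[OF this, of 0] show "smooth_real_on d W h"
    by simp
next
  assume h: "smooth_real_on d W h"
  note W = smooth_real_on_imp_openin[OF h]
  have s: "smooth_between d 1 W (\<lambda>w i. if i = 0 then h w else 0)"
    using h W by (simp add: smooth_between_def topspace_Euclidean_space)
  show "plot real_manifold d W h"
  proof (rule plotI[OF W])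
    show "h \<in> W \<rightarrow> topspace (mf_top real_manifold)"
      by (simp add: real_manifold_def)
    fix V assume "openin (mf_top real_manifold) V"
    then have V: "open V"
      by (simp add: real_manifold_def)
    have "continuous_on W h"
      using h by (auto simp: smooth_real_on_def intro: C_k_imp_continuous_on)
    then have "openin (top_of_set W) (W \<inter> h -` V)"
      using V by (rule continuous_openin_preimage_gen)
    then have "openin (subtopology (Euclidean_space d) W) (W \<inter> h -` V)"
      by (simp add: subtopology_Euclidean_space[OF openin_subset[OF W]])
    then have "openin (Euclidean_space d) (W \<inter> h -` V)"
      by (rule openin_trans_full[OF _ W])
    moreover have "W \<inter> h -` V = {w \<in> W. h w \<in> V}"
      by auto
    ultimately show "openin (Euclidean_space d) {w \<in> W. h w \<in> V}"
      by simp
  qed (use s in \<open>simp add: real_manifold_def\<close>)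
qed

section \<open>Local trivializations and local frames\<close>

lemma smooth_vector_bundle_charted:
  assumes "smooth_vector_bundle B"
  shows "charted (vb_total B)" "charted (vb_base B)"
  using assms by (simp_all add: smooth_vector_bundle_def smooth_manifold_imp_charted)

lemma vb_fibre_closed:
  assumes B: "smooth_vector_bundle B" and x: "x \<in> topspace (mf_top (vb_base B))"
  shows "a \<in> vb_fibre B x \<Longrightarrow> b \<in> vb_fibre B x \<Longrightarrow> vb_add B a b \<in> vb_fibre B x"
    and "a \<in> vb_fibre B x \<Longrightarrow> vb_scale B r a \<in> vb_fibre B x"
proof -
  have vs: "real_vector_space_on (vb_fibre B x) (vb_add B) (vb_scale B)"
    using B x by (simp add: smooth_vector_bundle_def)
  have "\<forall>a\<in>vb_fibre B x. \<forall>b\<in>vb_fibre B x. vb_add B a b \<in> vb_fibre B x"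
    using vs unfolding real_vector_space_on_def by (elim conjE)
  then show "a \<in> vb_fibre B x \<Longrightarrow> b \<in> vb_fibre B x \<Longrightarrow> vb_add B a b \<in> vb_fibre B x"
    by blast
  have "\<forall>r. \<forall>a\<in>vb_fibre B x. vb_scale B r a \<in> vb_fibre B x"
    using vs unfolding real_vector_space_on_def by (elim conjE)
  then show "a \<in> vb_fibre B x \<Longrightarrow> vb_scale B r a \<in> vb_fibre B x"
    by blast
qed

lemma local_trivialization_exists:
  assumes "smooth_vector_bundle B" "x \<in> topspace (mf_top (vb_base B))"
  obtains U \<psi> where "x \<in> U" "local_trivialization B U \<psi>"
  using assms unfolding smooth_vector_bundle_def by blast

lemma local_trivialization_base:
  assumes "local_trivialization B U \<psi>"
  shows "openin (mf_top (vb_base B)) U" "U \<subseteq> topspace (mf_top (vb_base B))"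
  using assms openin_subset unfolding local_trivialization_def by blast+

lemma topspace_vb_preimage:
  "topspace (mf_top (open_submanifold (vb_total B) (vb_preimage B U))) = vb_preimage B U"
  by (auto simp: open_submanifold_def vb_preimage_def)

lemma local_trivialization_bij:
  assumes "local_trivialization B U \<psi>"
  shows "bij_betw \<psi> (vb_preimage B U) (U \<times> topspace (Euclidean_space (vb_rank B)))"
proof -
  have "topspace (mf_top (product_manifold (open_submanifold (vb_base B) U)
      (euclidean_manifold (vb_rank B)))) = U \<times> topspace (Euclidean_space (vb_rank B))"
    using local_trivialization_base(2)[OF assms]
    by (simp add: product_manifold_def open_submanifold_def euclidean_manifold_def Int_absorb1)
  then show ?thesis
    using assms topspace_vb_preimage[of B U]
    by (simp add: local_trivialization_def manifold_diffeomorphism_def)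
qed

lemma local_trivialization_inverse:
  assumes t: "local_trivialization B U \<psi>"
    and x: "x \<in> U" and c: "c \<in> topspace (Euclidean_space (vb_rank B))"
  shows "inv_into (vb_preimage B U) \<psi> (x, c) \<in> vb_fibre B x"
    and "\<psi> (inv_into (vb_preimage B U) \<psi> (x, c)) = (x, c)"
proof -
  note b = local_trivialization_bij[OF t]
  have img: "(x, c) \<in> \<psi> ` vb_preimage B U"
    using b x c by (simp add: bij_betw_def)
  show eq: "\<psi> (inv_into (vb_preimage B U) \<psi> (x, c)) = (x, c)"
    by (rule f_inv_into_f[OF img])
  have pre: "inv_into (vb_preimage B U) \<psi> (x, c) \<in> vb_preimage B U"
    by (rule inv_into_into[OF img])
  then have "vb_proj B (inv_into (vb_preimage B U) \<psi> (x, c)) = x"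
    using t eq unfolding local_trivialization_def by fastforce
  with pre show "inv_into (vb_preimage B U) \<psi> (x, c) \<in> vb_fibre B x"
    by (simp add: vb_preimage_def)
qed

lemma local_trivialization_fibre:
  assumes t: "local_trivialization B U \<psi>" and x: "x \<in> U" and v: "v \<in> vb_fibre B x"
  shows "\<psi> v = (x, snd (\<psi> v))" "snd (\<psi> v) \<in> topspace (Euclidean_space (vb_rank B))"
    "inv_into (vb_preimage B U) \<psi> (x, snd (\<psi> v)) = v"
proof -
  note b = local_trivialization_bij[OF t]
  have pre: "v \<in> vb_preimage B U" and proj: "vb_proj B v = x"
    using v x by (auto simp: vb_preimage_def)
  have "fst (\<psi> v) = x"
    using t pre proj by (simp add: local_trivialization_def)
  then show eq: "\<psi> v = (x, snd (\<psi> v))"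
    by (metis prod.collapse)
  have "\<psi> v \<in> U \<times> topspace (Euclidean_space (vb_rank B))"
    using bij_betwE[OF b] pre by blast
  then show "snd (\<psi> v) \<in> topspace (Euclidean_space (vb_rank B))"
    by (simp add: mem_Times_iff)
  show "inv_into (vb_preimage B U) \<psi> (x, snd (\<psi> v)) = v"
    unfolding eq[symmetric] by (rule inv_into_f_f[OF bij_betw_imp_inj_on[OF b] pre])
qed

text \<open>
  The fibre coordinates of a plot are smooth, because \<open>\<psi>\<close> is a smooth map to a product whose second
  factor is Euclidean. The companion statement for \<open>\<psi>\<^sup>-\<^sup>1\<close> turns smooth coordinates into plots of the
  total space, in particular local frames along plots of the base.
\<close>

lemma local_trivialization_plot:
  assumes B: "smooth_vector_bundle B" and t: "local_trivialization B U \<psi>"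
    and q: "plot (vb_total B) d W q" and qU: "q \<in> W \<rightarrow> vb_preimage B U"
  shows "smooth_between d (vb_rank B) W (\<lambda>w. snd (\<psi> (q w)))"
proof -
  note ch = charted_open_submanifold[OF smooth_vector_bundle_charted(1)[OF B]]
    charted_open_submanifold[OF smooth_vector_bundle_charted(2)[OF B]]
  have "plot (open_submanifold (vb_total B) (vb_preimage B U)) d W q"
    using q qU by (simp add: plot_open_submanifold_iff)
  then have "plot (product_manifold (open_submanifold (vb_base B) U)
      (euclidean_manifold (vb_rank B))) d W (\<lambda>w. \<psi> (q w))"
    by (rule smooth_manifold_map_plot[OF ch(1), rotated])
      (use t in \<open>simp add: local_trivialization_def manifold_diffeomorphism_def\<close>)
  from plot_product_manifold_snd[OF ch(2) this] show ?thesis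
    by (simp add: plot_euclidean_manifold_iff)
qed

lemma local_trivialization_inverse_plot:
  assumes B: "smooth_vector_bundle B" and t: "local_trivialization B U \<psi>"
    and b: "plot (vb_base B) d W b" and bU: "b \<in> W \<rightarrow> U"
    and c: "smooth_between d (vb_rank B) W c"
  shows "plot (vb_total B) d W (\<lambda>w. inv_into (vb_preimage B U) \<psi> (b w, c w))"
proof -
  have ch: "charted (product_manifold (open_submanifold (vb_base B) U)
      (euclidean_manifold (vb_rank B)))"
    by (intro charted_product_manifold charted_open_submanifold charted_euclidean_manifold
        smooth_vector_bundle_charted(2)[OF B])
  have "plot (product_manifold (open_submanifold (vb_base B) U)
      (euclidean_manifold (vb_rank B))) d W (\<lambda>w. (b w, c w))"
    using b bU c
    by (intro plot_product_manifold)
      (simp_all add: plot_open_submanifold_iff plot_euclidean_manifold_iff)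
  then have "plot (open_submanifold (vb_total B) (vb_preimage B U)) d W
      (\<lambda>w. inv_into (vb_preimage B U) \<psi> (b w, c w))"
    by (rule smooth_manifold_map_plot[OF ch, rotated])
      (use t topspace_vb_preimage[of B U] in
        \<open>simp add: local_trivialization_def manifold_diffeomorphism_def\<close>)
  then show ?thesis
    by (simp add: plot_open_submanifold_iff)
qed

abbreviation local_frame ::
    "('e, 'm) vector_bundle \<Rightarrow> 'm set \<Rightarrow> ('e \<Rightarrow> 'm \<times> (nat \<Rightarrow> real)) \<Rightarrow> 'm \<Rightarrow> nat \<Rightarrow> 'e" where
  "local_frame B U \<psi> x j \<equiv> inv_into (vb_preimage B U) \<psi> (x, \<lambda>i. if i = j then 1 else 0)"

text \<open>
  Linearity of \<open>\<psi>\<close> on a fibre passes to the inverse, because \<open>\<psi>\<close> is injective and fibres are closed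
  under the operations.
\<close>

lemma local_trivialization_inverse_linear:
  assumes B: "smooth_vector_bundle B" and t: "local_trivialization B U \<psi>" and x: "x \<in> U"
    and c: "c \<in> topspace (Euclidean_space (vb_rank B))"
  defines "s \<equiv> \<lambda>c. inv_into (vb_preimage B U) \<psi> (x, c)"
  shows "c' \<in> topspace (Euclidean_space (vb_rank B)) \<Longrightarrow>
      s (\<lambda>i. c i + c' i) = vb_add B (s c) (s c')"
    and "s (\<lambda>i. r * c i) = vb_scale B r (s c)"
proof -
  have "x \<in> topspace (mf_top (vb_base B))"
    using x local_trivialization_base(2)[OF t] by blast
  note closed = vb_fibre_closed[OF B this]
  have s: "s c \<in> vb_fibre B x" "snd (\<psi> (s c)) = c"
    if "c \<in> topspace (Euclidean_space (vb_rank B))" for c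
    using local_trivialization_inverse[OF t x that] by (simp_all add: s_def)
  show "s (\<lambda>i. c i + c' i) = vb_add B (s c) (s c')"
    if c': "c' \<in> topspace (Euclidean_space (vb_rank B))"
  proof -
    have "vb_add B (s c) (s c') \<in> vb_fibre B x"
      by (rule closed(1)[OF s(1)[OF c] s(1)[OF c']])
    moreover have "snd (\<psi> (vb_add B (s c) (s c'))) = (\<lambda>i. c i + c' i)"
      using t x s[OF c] s[OF c'] unfolding local_trivialization_def by simp
    ultimately show ?thesis
      using local_trivialization_fibre(3)[OF t x] by (fastforce simp: s_def)
  qed
  have "vb_scale B r (s c) \<in> vb_fibre B x"
    by (rule closed(2)[OF s(1)[OF c]])
  moreover have "snd (\<psi> (vb_scale B r (s c))) = (\<lambda>i. r * c i)"
    using t x s[OF c] unfolding local_trivialization_def by simp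
  ultimately show "s (\<lambda>i. r * c i) = vb_scale B r (s c)"
    using local_trivialization_fibre(3)[OF t x] by (fastforce simp: s_def)
qed

text \<open>
  The expansion of a covector in the frame dual to \<open>local_frame\<close>. The induction is on the number \<open>m\<close>
  of coordinates that may be nonzero: splitting off the last one uses additivity and homogeneity once.
\<close>

lemma linear_functional_frame_expansion:
  assumes B: "smooth_vector_bundle B" and t: "local_trivialization B U \<psi>" and x: "x \<in> U"
    and \<xi>: "\<xi> \<in> linear_functionals (vb_fibre B x) (vb_add B) (vb_scale B)"
    and v: "v \<in> vb_fibre B x"
  shows "\<xi> v = (\<Sum>j<vb_rank B. snd (\<psi> v) j * \<xi> (local_frame B U \<psi> x j))"
proof -
  define s where "s c = inv_into (vb_preimage B U) \<psi> (x, c)" for c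
  note lin = local_trivialization_inverse_linear[OF B t x, folded s_def]
  have s: "s c \<in> vb_fibre B x" if "c \<in> topspace (Euclidean_space (vb_rank B))" for c
    using local_trivialization_inverse(1)[OF t x that] by (simp add: s_def)
  have \<xi>_add: "\<xi> (vb_add B a b) = \<xi> a + \<xi> b" if "a \<in> vb_fibre B x" "b \<in> vb_fibre B x" for a b
    using \<xi> that by (simp add: linear_functionals_def)
  have \<xi>_scale: "\<xi> (vb_scale B r a) = r * \<xi> a" if "a \<in> vb_fibre B x" for r a
    using \<xi> that by (simp add: linear_functionals_def)
  have "\<xi> (s c) = (\<Sum>j<m. c j * \<xi> (local_frame B U \<psi> x j))"
    if "m \<le> vb_rank B" "c \<in> topspace (Euclidean_space m)" for m c
    using that
  proof (induction m arbitrary: c)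
    case 0
    then have c: "c \<in> topspace (Euclidean_space (vb_rank B))" and "c = (\<lambda>i. 0 * c i)"
      by (auto simp: topspace_Euclidean_space)
    then have "s c = vb_scale B 0 (s c)"
      using lin(2)[OF c, of 0] by simp
    then have "\<xi> (s c) = 0 * \<xi> (s c)"
      using \<xi>_scale[OF s[OF c], of 0] by simp
    then show ?case by simp
  next
    case (Suc m)
    define e :: "nat \<Rightarrow> real" where "e = (\<lambda>i. if i = m then 1 else 0)"
    define c0 where "c0 = c(m := 0)"
    have e: "e \<in> topspace (Euclidean_space (vb_rank B))"
      using Suc.prems(1) by (simp add: e_def topspace_Euclidean_space)
    have c0m: "c0 \<in> topspace (Euclidean_space m)"
      using Suc.prems(2) by (auto simp: c0_def topspace_Euclidean_space)
    then have c0: "c0 \<in> topspace (Euclidean_space (vb_rank B))"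
      using Suc.prems(1) by (simp add: topspace_Euclidean_space)
    have ce: "(\<lambda>i. c m * e i) \<in> topspace (Euclidean_space (vb_rank B))"
      using e by (simp add: topspace_Euclidean_space)
    have "c = (\<lambda>i. c0 i + c m * e i)"
      by (auto simp: c0_def e_def)
    then have "s c = vb_add B (s c0) (vb_scale B (c m) (s e))"
      using lin(1)[OF c0 ce] lin(2)[OF e, of "c m"] by simp
    moreover have "s (\<lambda>i. c m * e i) = vb_scale B (c m) (s e)"
      by (rule lin(2)[OF e])
    then have "vb_scale B (c m) (s e) \<in> vb_fibre B x"
      using s[OF ce] by simp
    ultimately have "\<xi> (s c) = \<xi> (s c0) + c m * \<xi> (s e)"
      using \<xi>_add[OF s[OF c0]] \<xi>_scale[OF s[OF e]] by simp
    also have "\<xi> (s c0) = (\<Sum>j<m. c0 j * \<xi> (local_frame B U \<psi> x j))"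
      by (rule Suc.IH) (use Suc.prems(1) c0m in simp_all)
    also have "\<dots> = (\<Sum>j<m. c j * \<xi> (local_frame B U \<psi> x j))"
      by (rule sum.cong) (simp_all add: c0_def)
    finally show ?case
      by (simp add: s_def e_def)
  qed
  from this[OF order_refl local_trivialization_fibre(2)[OF t x v]] show ?thesis
    using local_trivialization_fibre(3)[OF t x v] by (simp add: s_def)
qed

section \<open>The two dual bundles\<close>

lemma standard_pseudo_bundle_simps:
  "df_plot (pb_total (standard_pseudo_bundle B)) = plot (vb_total B)"
  "df_plot (pb_base (standard_pseudo_bundle B)) = plot (vb_base B)"
  "df_points (pb_total (standard_pseudo_bundle B)) = topspace (mf_top (vb_total B))"
  "df_points (pb_base (standard_pseudo_bundle B)) = topspace (mf_top (vb_base B))"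
  "pb_proj (standard_pseudo_bundle B) = vb_proj B"
  "pb_add (standard_pseudo_bundle B) = vb_add B"
  "pb_scale (standard_pseudo_bundle B) = vb_scale B"
  "pb_fibre (standard_pseudo_bundle B) x = vb_fibre B x"
  by (simp_all add: standard_pseudo_bundle_def standard_diffeology_def pb_fibre_def vb_preimage_def)

text \<open>
  A linear functional on a fibre is smooth there, as it is a linear combination of the fibre
  coordinates with constant coefficients.
\<close>

lemma diff_dual_points_standard_pseudo_bundle:
  assumes B: "smooth_vector_bundle B"
  shows "diff_dual_points (standard_pseudo_bundle B) = dual_bundle_points B"
proof -
  have "diffeologically_smooth
      (subset_diffeology (pb_total (standard_pseudo_bundle B)) (vb_fibre B x))
      (standard_diffeology real_manifold) \<xi>"
    if x: "x \<in> topspace (mf_top (vb_base B))"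
      and \<xi>: "\<xi> \<in> linear_functionals (vb_fibre B x) (vb_add B) (vb_scale B)" for x \<xi>
    unfolding diffeologically_smooth_def
  proof (intro conjI allI impI)
    show "\<xi> \<in> df_points (subset_diffeology (pb_total (standard_pseudo_bundle B)) (vb_fibre B x)) \<rightarrow>
        df_points (standard_diffeology real_manifold)"
      by (simp add: standard_diffeology_def real_manifold_def)
    fix d W q
    assume "df_plot (subset_diffeology (pb_total (standard_pseudo_bundle B)) (vb_fibre B x)) d W q"
    then have q: "plot (vb_total B) d W q" and qx: "q \<in> W \<rightarrow> vb_fibre B x"
      by (simp_all add: subset_diffeology_def standard_pseudo_bundle_simps)
    obtain U \<psi> where U: "x \<in> U" and t: "local_trivialization B U \<psi>"
      using local_trivialization_exists[OF B x] by blast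
    have "q \<in> W \<rightarrow> vb_preimage B U"
      using qx U by (auto simp: vb_preimage_def)
    note s = local_trivialization_plot[OF B t q this]
    have "smooth_real_on d W (\<lambda>w. \<Sum>j<vb_rank B. snd (\<psi> (q w)) j * \<xi> (local_frame B U \<psi> x j))"
      by (intro smooth_real_on_sum smooth_real_on_mult smooth_real_on_const
          smooth_between_coordinate[OF s] smooth_betweenD(1)[OF s]) simp
    then have "smooth_real_on d W (\<lambda>w. \<xi> (q w))"
      by (rule smooth_real_on_cong)
        (rule linear_functional_frame_expansion[OF B t U \<xi> funcset_mem[OF qx], symmetric])
    then show "plot real_manifold d W (\<xi> \<circ> q)"
      by (simp add: plot_real_manifold_iff comp_def)
  qed
  then show ?thesis
    by (auto simp: diff_dual_points_def dual_bundle_points_def standard_pseudo_bundle_simps)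
qed

lemma dual_bundle_simps:
  "mf_dim (vb_total (dual_bundle B)) = mf_dim (vb_base B) + vb_rank B"
  "mf_atlas (vb_total (dual_bundle B)) = dual_bundle_atlas B"
  "vb_proj (dual_bundle B) = fst"
  by (simp_all add: dual_bundle_def)

lemma dual_bundle_chart_eq:
  "dual_bundle_chart B U \<phi> \<psi> v =
     join_coords (mf_dim (vb_base B)) (\<phi> (fst v))
       (\<lambda>j. if j < vb_rank B then snd v (local_frame B U \<psi> (fst v) j) else 0)"
  by (simp add: dual_bundle_chart_def case_prod_beta)

lemma dual_bundle_chart_in_Euclidean_space:
  "dual_bundle_chart B U \<phi> \<psi> v \<in> topspace (Euclidean_space (mf_dim (vb_base B) + vb_rank B))"
  by (auto simp: dual_bundle_chart_eq join_coords_def topspace_Euclidean_space)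

lemma dual_bundle_atlasI:
  assumes "(W, \<phi>) \<in> mf_atlas (vb_base B)" "local_trivialization B U \<psi>"
  shows "({v \<in> dual_bundle_points B. fst v \<in> U \<inter> W}, dual_bundle_chart B U \<phi> \<psi>) \<in> dual_bundle_atlas B"
  using assms unfolding dual_bundle_atlas_def by blast

lemma dual_bundle_atlasE:
  assumes "(D, \<kappa>) \<in> dual_bundle_atlas B"
  obtains U W \<phi> \<psi> where "(W, \<phi>) \<in> mf_atlas (vb_base B)" "local_trivialization B U \<psi>"
    "D = {v \<in> dual_bundle_points B. fst v \<in> U \<inter> W}" "\<kappa> = dual_bundle_chart B U \<phi> \<psi>"
  using assms unfolding dual_bundle_atlas_def by blast

lemma topspace_dual_bundle:
  assumes B: "smooth_vector_bundle B"
  shows "topspace (mf_top (vb_total (dual_bundle B))) = dual_bundle_points B"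
proof -
  let ?S = "{{v \<in> D. \<kappa> v \<in> Q} | D \<kappa> Q. (D, \<kappa>) \<in> dual_bundle_atlas B \<and>
    openin (Euclidean_space (mf_dim (vb_base B) + vb_rank B)) Q}"
  have "\<Union>?S = dual_bundle_points B"
  proof (intro equalityI subsetI)
    fix v assume "v \<in> \<Union>?S"
    then obtain D \<kappa> where "(D, \<kappa>) \<in> dual_bundle_atlas B" "v \<in> D"
      by blast
    then show "v \<in> dual_bundle_points B"
      by (auto elim!: dual_bundle_atlasE)
  next
    fix v assume v: "v \<in> dual_bundle_points B"
    then have x: "fst v \<in> topspace (mf_top (vb_base B))"
      by (auto simp: dual_bundle_points_def)
    obtain W \<phi> where W: "(W, \<phi>) \<in> mf_atlas (vb_base B)" "fst v \<in> W"
      using chartedD(1)[OF smooth_vector_bundle_charted(2)[OF B] x] by blast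
    obtain U \<psi> where U: "fst v \<in> U" "local_trivialization B U \<psi>"
      using local_trivialization_exists[OF B x] by blast
    let ?Q = "topspace (Euclidean_space (mf_dim (vb_base B) + vb_rank B))"
    let ?D = "{v \<in> dual_bundle_points B. fst v \<in> U \<inter> W}"
    have "{v \<in> ?D. dual_bundle_chart B U \<phi> \<psi> v \<in> ?Q} \<in> ?S"
      using dual_bundle_atlasI[OF W(1) U(2)] openin_topspace by blast
    moreover have "v \<in> {v \<in> ?D. dual_bundle_chart B U \<phi> \<psi> v \<in> ?Q}"
      using v W(2) U(1) dual_bundle_chart_in_Euclidean_space by blast
    ultimately show "v \<in> \<Union>?S"
      by blast
  qed
  then show ?thesis
    by (simp add: dual_bundle_def topology_generated_by_topspace)
qed

lemma diffeological_space_dual_bundle: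
  "diffeological_space (standard_diffeology (vb_total (dual_bundle B)))"
  by (rule diffeological_space_standard_diffeology)
    (auto simp: dual_bundle_simps dual_bundle_chart_in_Euclidean_space elim!: dual_bundle_atlasE)

text \<open>
  A chart of the dual bundle lists the coordinates of the base point and the coefficients in a local
  frame. Each half of the list is smooth on the common domain of a chart and a trivialization; these
  domains cover, so each half is smooth wherever it is defined.
\<close>

lemma dual_bundle_plotD:
  assumes B: "smooth_vector_bundle B" and p: "plot (vb_total (dual_bundle B)) d W p"
  shows "plot (vb_base B) d W (\<lambda>w. fst (p w))"
    and "local_trivialization B U \<psi> \<Longrightarrow> j < vb_rank B \<Longrightarrow>
      smooth_real_on d {w \<in> W. fst (p w) \<in> U} (\<lambda>w. snd (p w) (local_frame B U \<psi> (fst (p w)) j))"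
proof -
  define coeff where "coeff U \<psi> w = (\<lambda>j. if j < vb_rank B
    then snd (p w) (local_frame B U \<psi> (fst (p w)) j) else 0)" for U \<psi> w
  note M = smooth_vector_bundle_charted(2)[OF B]
  have pts: "p w \<in> dual_bundle_points B" if "w \<in> W" for w
    using funcset_mem[OF plotD(2)[OF p] that] by (simp add: topspace_dual_bundle[OF B])
  then have base: "fst (p w) \<in> topspace (mf_top (vb_base B))" if "w \<in> W" for w
    using that by (simp add: dual_bundle_points_def case_prod_beta)
  have s: "smooth_between d (mf_dim (vb_base B) + vb_rank B) {w \<in> W. fst (p w) \<in> U \<inter> V}
      (\<lambda>w. join_coords (mf_dim (vb_base B)) (\<phi> (fst (p w))) (coeff U \<psi> w))"
    if "(V, \<phi>) \<in> mf_atlas (vb_base B)" "local_trivialization B U \<psi>" for U V \<phi> \<psi>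
  proof -
    have "{w \<in> W. p w \<in> {v \<in> dual_bundle_points B. fst v \<in> U \<inter> V}} = {w \<in> W. fst (p w) \<in> U \<inter> V}"
      using pts by auto
    then show ?thesis
      using plotD(4)[OF p, unfolded dual_bundle_simps, OF dual_bundle_atlasI[OF that]]
      by (simp add: dual_bundle_chart_eq coeff_def)
  qed
  show "plot (vb_base B) d W (\<lambda>w. fst (p w))"
  proof (rule plot_if_smooth_in_charts)
    show "smooth_manifold (vb_base B)"
      using B by (simp add: smooth_vector_bundle_def)
    show "openin (Euclidean_space d) W" by (rule plotD(1)[OF p])
    show "(\<lambda>w. fst (p w)) \<in> W \<rightarrow> topspace (mf_top (vb_base B))"
      using base by simp
    fix V \<phi> assume V: "(V, \<phi>) \<in> mf_atlas (vb_base B)"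
    show "smooth_between d (mf_dim (vb_base B)) {w \<in> W. fst (p w) \<in> V} (\<lambda>w. \<phi> (fst (p w)))"
    proof (rule smooth_between_local)
      fix w assume w: "w \<in> {w \<in> W. fst (p w) \<in> V}"
      then obtain U \<psi> where U: "fst (p w) \<in> U" "local_trivialization B U \<psi>"
        using local_trivialization_exists[OF B base] by blast
      have "smooth_between d (mf_dim (vb_base B)) {w \<in> W. fst (p w) \<in> U \<inter> V} (\<lambda>w. \<phi> (fst (p w)))"
        by (rule smooth_between_join_fst[OF s[OF V U(2)]]) (use chartedD(4)[OF M V] in auto)
      then show "\<exists>T. w \<in> T \<and> T \<subseteq> {w \<in> W. fst (p w) \<in> V} \<and>
          smooth_between d (mf_dim (vb_base B)) T (\<lambda>w. \<phi> (fst (p w)))"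
        by (intro exI[of _ "{w \<in> W. fst (p w) \<in> U \<inter> V}"]) (use w U(1) in auto)
    qed
  qed
  show "smooth_real_on d {w \<in> W. fst (p w) \<in> U} (\<lambda>w. snd (p w) (local_frame B U \<psi> (fst (p w)) j))"
    if t: "local_trivialization B U \<psi>" and j: "j < vb_rank B"
  proof (rule smooth_real_on_local)
    fix w assume w: "w \<in> {w \<in> W. fst (p w) \<in> U}"
    then obtain V \<phi> where V: "(V, \<phi>) \<in> mf_atlas (vb_base B)" "fst (p w) \<in> V"
      using chartedD(1)[OF M base] by blast
    have "smooth_real_on d {w \<in> W. fst (p w) \<in> U \<inter> V} (\<lambda>w. coeff U \<psi> w j)"
      by (rule smooth_between_coordinate[OF smooth_between_join_snd[OF s[OF V(1) t]]])
    then show "\<exists>T. w \<in> T \<and> T \<subseteq> {w \<in> W. fst (p w) \<in> U} \<and>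
        smooth_real_on d T (\<lambda>w. snd (p w) (local_frame B U \<psi> (fst (p w)) j))"
      using j by (intro exI[of _ "{w \<in> W. fst (p w) \<in> U \<inter> V}"])
        (use w V(2) in \<open>auto simp: coeff_def\<close>)
  qed
qed

text \<open>
  The topology of the dual bundle is generated by the preimages of open sets under its charts.
  Continuity therefore follows from smoothness of the chart expressions.
\<close>

lemma dual_bundle_plotI:
  assumes B: "smooth_vector_bundle B" and pD: "p \<in> W \<rightarrow> dual_bundle_points B"
    and base: "plot (vb_base B) d W (\<lambda>w. fst (p w))"
    and coeff: "\<And>U \<psi> j. local_trivialization B U \<psi> \<Longrightarrow> j < vb_rank B \<Longrightarrow>
      smooth_real_on d {w \<in> W. fst (p w) \<in> U} (\<lambda>w. snd (p w) (local_frame B U \<psi> (fst (p w)) j))"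
  shows "plot (vb_total (dual_bundle B)) d W p"
proof -
  note W = plotD(1)[OF base]
  have top: "topspace (subtopology (Euclidean_space d) W) = W"
    using openin_subset[OF W] by (simp add: Int_absorb1)
  have smooth: "smooth_between d (mf_dim (vb_base B) + vb_rank B) {w \<in> W. p w \<in> D} (\<lambda>w. \<kappa> (p w))"
    if "(D, \<kappa>) \<in> dual_bundle_atlas B" for D \<kappa>
    using that
  proof (rule dual_bundle_atlasE)
    fix U V \<phi> \<psi>
    assume V: "(V, \<phi>) \<in> mf_atlas (vb_base B)" and t: "local_trivialization B U \<psi>"
      and D: "D = {v \<in> dual_bundle_points B. fst v \<in> U \<inter> V}" and \<kappa>: "\<kappa> = dual_bundle_chart B U \<phi> \<psi>"
    define T where "T = {w \<in> W. fst (p w) \<in> U} \<inter> {w \<in> W. fst (p w) \<in> V}"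
    note sV = plotD(4)[OF base V]
    have TU: "openin (Euclidean_space d) {w \<in> W. fst (p w) \<in> U}"
      by (rule plotD(3)[OF base local_trivialization_base(1)[OF t]])
    have T: "openin (Euclidean_space d) T"
      unfolding T_def by (intro openin_Int TU smooth_betweenD(1)[OF sV])
    have "smooth_between d (mf_dim (vb_base B)) T (\<lambda>w. \<phi> (fst (p w)))"
      by (rule smooth_between_subset[OF sV T]) (auto simp: T_def)
    moreover have "smooth_between d (vb_rank B) T (\<lambda>w j. if j < vb_rank B
        then snd (p w) (local_frame B U \<psi> (fst (p w)) j) else 0)"
      unfolding smooth_between_def
      using T smooth_real_on_subset[OF coeff[OF t] T]
      by (auto simp: T_def topspace_Euclidean_space)
    moreover have "{w \<in> W. p w \<in> D} = T"
      using pD by (auto simp: D T_def)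
    ultimately show ?thesis
      using smooth_between_join unfolding \<kappa> dual_bundle_chart_eq by simp
  qed
  let ?S = "{{v \<in> D. \<kappa> v \<in> Q} | D \<kappa> Q. (D, \<kappa>) \<in> dual_bundle_atlas B \<and>
    openin (Euclidean_space (mf_dim (vb_base B) + vb_rank B)) Q}"
  have mf_top: "mf_top (vb_total (dual_bundle B)) = topology_generated_by ?S"
    by (simp add: dual_bundle_def)
  have "continuous_map (subtopology (Euclidean_space d) W) (topology_generated_by ?S) p"
    unfolding continuous_on_generated_topo_iff top
  proof (intro conjI allI impI)
    fix X assume "X \<in> ?S"
    then obtain D \<kappa> Q where X: "X = {v \<in> D. \<kappa> v \<in> Q}" "(D, \<kappa>) \<in> dual_bundle_atlas B"
      "openin (Euclidean_space (mf_dim (vb_base B) + vb_rank B)) Q"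
      by blast
    have "openin (Euclidean_space d) {w \<in> {w \<in> W. p w \<in> D}. \<kappa> (p w) \<in> Q}"
      by (rule smooth_between_openin_preimage[OF smooth[OF X(2)] X(3)])
    moreover have "{w \<in> {w \<in> W. p w \<in> D}. \<kappa> (p w) \<in> Q} = p -` X \<inter> W"
      by (auto simp: X(1))
    ultimately show "openin (subtopology (Euclidean_space d) W) (p -` X \<inter> W)"
      by (simp add: openin_open_subtopology[OF W])
  next
    show "p ` W \<subseteq> \<Union>?S"
      using pD topspace_dual_bundle[OF B] unfolding mf_top topology_generated_by_topspace by blast
  qed
  then have cont: "continuous_map (subtopology (Euclidean_space d) W) (mf_top (vb_total (dual_bundle B))) p"
    unfolding mf_top .
  show ?thesis
  proof (rule plotI[OF W])
    show "p \<in> W \<rightarrow> topspace (mf_top (vb_total (dual_bundle B)))"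
      using pD by (simp add: topspace_dual_bundle[OF B])
    show "openin (Euclidean_space d) {w \<in> W. p w \<in> X}"
      if "openin (mf_top (vb_total (dual_bundle B))) X" for X
      using openin_continuous_map_preimage[OF cont that, unfolded top]
      by (simp add: openin_open_subtopology[OF W])
    show "smooth_between d (mf_dim (vb_total (dual_bundle B))) {w \<in> W. p w \<in> D} (\<lambda>w. \<kappa> (p w))"
      if "(D, \<kappa>) \<in> mf_atlas (vb_total (dual_bundle B))" for D \<kappa>
      using smooth that by (simp add: dual_bundle_simps)
  qed
qed

text \<open>
  If \<open>q(u')\<close> lies in the fibre over the base point of \<open>p(u)\<close>, then near such a pair
  \<open>p(u)(q(u')) = \<Sum>\<^sub>j q(u')\<^sub>j * p(u)(e\<^sub>j)\<close> with respect to a local frame \<open>e\<^sub>j\<close>. The coordinates of \<open>q\<close> are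
  smooth in \<open>u'\<close> and the coefficients of \<open>p\<close> are smooth in \<open>u\<close>.
\<close>

lemma smooth_pairingI:
  assumes B: "smooth_vector_bundle B" and pD: "p \<in> W \<rightarrow> dual_bundle_points B"
    and base: "plot (vb_base B) d W (\<lambda>w. fst (p w))"
    and coeff: "\<And>U \<psi> j. local_trivialization B U \<psi> \<Longrightarrow> j < vb_rank B \<Longrightarrow>
      smooth_real_on d {w \<in> W. fst (p w) \<in> U} (\<lambda>w. snd (p w) (local_frame B U \<psi> (fst (p w)) j))"
  shows "smooth_pairing (standard_pseudo_bundle B) d W p"
  unfolding smooth_pairing_def diffeologically_smooth_def standard_pseudo_bundle_simps
proof (intro allI impI conjI)
  fix d' W' q e Y r
  assume q: "plot (vb_total B) d' W' q"
    and "df_plot (subset_diffeology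
        (standard_diffeology (product_manifold (open_submanifold (euclidean_manifold d) W)
          (open_submanifold (euclidean_manifold d') W')))
        {(u, u') \<in> W \<times> W'. fst (p u) = vb_proj B (q u')}) e Y r"
  then have r: "plot (product_manifold (open_submanifold (euclidean_manifold d) W)
        (open_submanifold (euclidean_manifold d') W')) e Y r"
    and rY: "r \<in> Y \<rightarrow> {(u, u') \<in> W \<times> W'. fst (p u) = vb_proj B (q u')}"
    by (simp_all add: subset_diffeology_def)
  define f g where "f = (\<lambda>y. fst (r y))" and "g = (\<lambda>y. snd (r y))"
  have fg: "f y \<in> W" "g y \<in> W'" "fst (p (f y)) = vb_proj B (q (g y))" if "y \<in> Y" for y
    using funcset_mem[OF rY that] by (auto simp: f_def g_def case_prod_beta)
  note ch = charted_open_submanifold[OF charted_euclidean_manifold]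
  have f: "smooth_between e d Y f"
    using plot_product_manifold_fst[OF ch ch r]
    by (simp add: f_def plot_open_submanifold_iff plot_euclidean_manifold_iff)
  have g: "smooth_between e d' Y g"
    using plot_product_manifold_snd[OF ch r]
    by (simp add: g_def plot_open_submanifold_iff plot_euclidean_manifold_iff)
  have "smooth_real_on e Y (\<lambda>y. snd (p (f y)) (q (g y)))"
  proof (rule smooth_real_on_local)
    fix y assume y: "y \<in> Y"
    have "fst (p (f y)) \<in> topspace (mf_top (vb_base B))"
      using funcset_mem[OF plotD(2)[OF base] fg(1)[OF y]] .
    then obtain U \<psi> where U: "fst (p (f y)) \<in> U" and t: "local_trivialization B U \<psi>"
      using local_trivialization_exists[OF B] by blast
    define N where "N = {y \<in> Y. f y \<in> {w \<in> W. fst (p w) \<in> U}}"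
    have N: "openin (Euclidean_space e) N"
      unfolding N_def
      by (rule smooth_between_openin_preimage[OF f plotD(3)[OF base local_trivialization_base(1)[OF t]]])
    have NY: "N \<subseteq> Y" by (auto simp: N_def)
    have fibre: "q (g y) \<in> vb_fibre B (fst (p (f y)))" if "y \<in> N" for y
      using that NY fg[of y] funcset_mem[OF plotD(2)[OF q], of "g y"]
      by (auto simp: vb_preimage_def)
    have "plot (vb_total B) e N (\<lambda>y. q (g y))"
      by (rule plot_compose[OF q smooth_between_subset[OF g N NY]]) (use fg(2) NY in auto)
    moreover have "(\<lambda>y. q (g y)) \<in> N \<rightarrow> vb_preimage B U"
      using fibre by (auto simp: N_def vb_preimage_def)
    ultimately have comp: "smooth_between e (vb_rank B) N (\<lambda>y. snd (\<psi> (q (g y))))"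
      by (rule local_trivialization_plot[OF B t])
    have "smooth_real_on e N (\<lambda>y. \<Sum>j<vb_rank B.
        snd (\<psi> (q (g y))) j * snd (p (f y)) (local_frame B U \<psi> (fst (p (f y))) j))"
    proof (intro smooth_real_on_sum smooth_real_on_mult N)
      fix j assume "j \<in> {..<vb_rank B}"
      then have j: "j < vb_rank B" by simp
      show "smooth_real_on e N (\<lambda>y. snd (\<psi> (q (g y))) j)"
        by (rule smooth_between_coordinate[OF comp])
      show "smooth_real_on e N (\<lambda>y. snd (p (f y)) (local_frame B U \<psi> (fst (p (f y))) j))"
        by (rule smooth_real_on_compose[OF smooth_between_subset[OF f N NY] coeff[OF t j]])
          (auto simp: N_def)
    qed simp
    then have "smooth_real_on e N (\<lambda>y. snd (p (f y)) (q (g y)))"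
    proof (rule smooth_real_on_cong)
      fix y assume y: "y \<in> N"
      then have "fst (p (f y)) \<in> U" "p (f y) \<in> dual_bundle_points B"
        using pD by (auto simp: N_def)
      then show "(\<Sum>j<vb_rank B. snd (\<psi> (q (g y))) j *
          snd (p (f y)) (local_frame B U \<psi> (fst (p (f y))) j)) = snd (p (f y)) (q (g y))"
        using linear_functional_frame_expansion[OF B t _ _ fibre[OF y]]
        by (auto simp: dual_bundle_points_def)
    qed
    moreover have "y \<in> N"
      using y fg(1)[OF y] U by (simp add: N_def)
    ultimately show "\<exists>N. y \<in> N \<and> N \<subseteq> Y \<and> smooth_real_on e N (\<lambda>y. snd (p (f y)) (q (g y)))"
      using NY by blast
  qed
  then show "plot real_manifold e Y ((\<lambda>(u, u'). snd (p u) (q u')) \<circ> r)"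
    by (simp add: plot_real_manifold_iff f_def g_def comp_def case_prod_beta)
qed (simp add: standard_diffeology_def real_manifold_def)

text \<open>
  The frame vector \<open>e\<^sub>j\<close> over the base point of \<open>p(w)\<close> is itself a plot \<open>q\<close> of the total space, since the
  base points form a plot. The pairing of \<open>p\<close> and \<open>q\<close>, restricted to the diagonal \<open>w \<mapsto> (w, w)\<close>, is the
  \<open>j\<close>-th coefficient of \<open>p\<close>.
\<close>

lemma smooth_pairing_frame:
  assumes B: "smooth_vector_bundle B" and base: "plot (vb_base B) d W (\<lambda>w. fst (p w))"
    and pair: "smooth_pairing (standard_pseudo_bundle B) d W p"
    and t: "local_trivialization B U \<psi>" and j: "j < vb_rank B"
  shows "smooth_real_on d {w \<in> W. fst (p w) \<in> U} (\<lambda>w. snd (p w) (local_frame B U \<psi> (fst (p w)) j))"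
proof -
  define N where "N = {w \<in> W. fst (p w) \<in> U}"
  define q where "q w = local_frame B U \<psi> (fst (p w)) j" for w
  have N: "openin (Euclidean_space d) N"
    unfolding N_def by (rule plotD(3)[OF base local_trivialization_base(1)[OF t]])
  have NW: "N \<subseteq> W" by (auto simp: N_def)
  have e: "(\<lambda>i. if i = j then 1 else 0 :: real) \<in> topspace (Euclidean_space (vb_rank B))"
    using j by (simp add: topspace_Euclidean_space)
  have q: "plot (vb_total B) d N q"
    unfolding q_def
    by (rule local_trivialization_inverse_plot[OF B t plot_subset[OF base N NW] _ smooth_between_const[OF N e]])
      (simp add: N_def)
  have proj: "vb_proj B (q w) = fst (p w)" if "w \<in> N" for w
    using local_trivialization_inverse(1)[OF t _ e, of "fst (p w)"] that
    by (simp add: N_def q_def vb_preimage_def)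
  have "plot (product_manifold (open_submanifold (euclidean_manifold d) W)
      (open_submanifold (euclidean_manifold d) N)) d N (\<lambda>w. (w, w))"
    using smooth_between_id[OF N] NW
    by (intro plot_product_manifold) (auto simp: plot_open_submanifold_iff plot_euclidean_manifold_iff)
  moreover have "(\<lambda>w. (w, w)) \<in> N \<rightarrow> {(u, u') \<in> W \<times> N. fst (p u) = vb_proj B (q u')}"
    using NW proj by auto
  ultimately have "plot real_manifold d N ((\<lambda>(u, u'). snd (p u) (q u')) \<circ> (\<lambda>w. (w, w)))"
    using pair q
    unfolding smooth_pairing_def diffeologically_smooth_def standard_pseudo_bundle_simps
    by (simp add: subset_diffeology_def)
  then show ?thesis
    by (simp add: plot_real_manifold_iff comp_def q_def N_def)
qed

lemma diff_dual_eq_dual_bundle: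
  assumes B: "smooth_vector_bundle B"
  shows "pb_total (diff_dual (standard_pseudo_bundle B)) =
    standard_diffeology (vb_total (dual_bundle B))"
proof -
  have "openin (Euclidean_space d) W \<and> p \<in> W \<rightarrow> dual_bundle_points B \<and>
      plot (vb_base B) d W (fst \<circ> p) \<and> smooth_pairing (standard_pseudo_bundle B) d W p \<longleftrightarrow>
      plot (vb_total (dual_bundle B)) d W p" for d W p
  proof
    assume "openin (Euclidean_space d) W \<and> p \<in> W \<rightarrow> dual_bundle_points B \<and>
      plot (vb_base B) d W (fst \<circ> p) \<and> smooth_pairing (standard_pseudo_bundle B) d W p"
    then have *: "p \<in> W \<rightarrow> dual_bundle_points B" "plot (vb_base B) d W (\<lambda>w. fst (p w))"
      "smooth_pairing (standard_pseudo_bundle B) d W p"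
      by (simp_all add: comp_def)
    show "plot (vb_total (dual_bundle B)) d W p"
      by (rule dual_bundle_plotI[OF B *(1,2) smooth_pairing_frame[OF B *(2,3)]])
  next
    assume p: "plot (vb_total (dual_bundle B)) d W p"
    have pD: "p \<in> W \<rightarrow> dual_bundle_points B"
      using plotD(2)[OF p] by (simp add: topspace_dual_bundle[OF B])
    show "openin (Euclidean_space d) W \<and> p \<in> W \<rightarrow> dual_bundle_points B \<and>
      plot (vb_base B) d W (fst \<circ> p) \<and> smooth_pairing (standard_pseudo_bundle B) d W p"
      using plotD(1)[OF p] pD dual_bundle_plotD(1)[OF B p]
        smooth_pairingI[OF B pD dual_bundle_plotD(1)[OF B p] dual_bundle_plotD(2)[OF B p]]
      by (simp add: comp_def)
  qed
  moreover have "df_points (standard_diffeology (vb_total (dual_bundle B))) = dual_bundle_points B"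
    using topspace_dual_bundle[OF B] by (simp add: standard_diffeology_def)
  ultimately show ?thesis
    by (intro diffeological.equality ext)
      (simp_all add: diff_dual_def diff_dual_points_standard_pseudo_bundle[OF B]
        standard_pseudo_bundle_simps)
qed

theorem theorem3p5:
  fixes B :: "('e, 'm) vector_bundle"
    and A :: "('m set \<times> ('m \<Rightarrow> nat \<Rightarrow> real) \<times> ('e \<Rightarrow> 'm \<times> (nat \<Rightarrow> real))) set"
  assumes "smooth_vector_bundle B"
    and "finite A" and "local_trivialization_atlas B A"
  shows "\<exists>\<Phi>. diffeomorphism
                (pb_total (diff_dual (standard_pseudo_bundle B)))
                (standard_diffeology (vb_total (dual_bundle B))) \<Phi> \<and>
             (\<forall>v \<in> df_points (pb_total (diff_dual (standard_pseudo_bundle B))).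
                vb_proj (dual_bundle B) (\<Phi> v) = pb_proj (diff_dual (standard_pseudo_bundle B)) v)"
proof (intro exI[of _ "\<lambda>v. v"] conjI ballI)
  let ?Y = "standard_diffeology (vb_total (dual_bundle B))"
  have Y: "diffeological_space ?Y"
    by (rule diffeological_space_dual_bundle)
  have "df_plot ?Y d W (inv_into (df_points ?Y) (\<lambda>v. v) \<circ> p)" if "df_plot ?Y d W p" for d W p
  proof (rule plot_cong[OF that])
    fix w assume "w \<in> W"
    then have "p w \<in> df_points ?Y"
      using plotD(2)[OF that] by (auto simp: standard_diffeology_def)
    then show "p w = (inv_into (df_points ?Y) (\<lambda>v. v) \<circ> p) w"
      by (simp add: inv_into_f_f[where f = "\<lambda>v. v"])
  qed
  moreover have "inv_into (df_points ?Y) (\<lambda>v. v) \<in> df_points ?Y \<rightarrow> df_points ?Y"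
    by (simp add: inv_into_f_f[where f = "\<lambda>v. v"])
  moreover have "bij_betw (\<lambda>v. v) (df_points ?Y) (df_points ?Y)"
    by (simp add: bij_betw_def)
  ultimately show "diffeomorphism (pb_total (diff_dual (standard_pseudo_bundle B))) ?Y (\<lambda>v. v)"
    unfolding diff_dual_eq_dual_bundle[OF assms(1)]
    using Y by (simp add: diffeomorphism_def diffeologically_smooth_def comp_def)
  show "vb_proj (dual_bundle B) v = pb_proj (diff_dual (standard_pseudo_bundle B)) v" for v
    by (simp add: dual_bundle_simps diff_dual_def)
qed

end
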